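(* Let $m\ge 1$ be a fixed integer. For each $n> m$ let $U$ be an $n\times n$ Haar unitary random matrix and let $U_{[n,m]}$ be the $m\times m$ matrix obtained from $U$ by deleting its bottom $n-m$ rows and its last $n-m$ columns. Then, as $n\to\infty$, the normalized truncated matrix $$\sqrt{\frac{n}{m}}\;U_{[n,m]}$$ converges in distribution to the standard $m\times m$ non-selfadjoint Gaussian matrix.
   Context: An $n\times n$ Haar unitary random matrix is a random matrix with values in the group $\mathcal U(n)$ of $n\times n$ complex unitary matrices, distributed according to the normalized Haar measure on $\mathcal U(n)$. The standard $m\times m$ non-selfadjoint Gaussian matrix is the $m\times m$ random matrix whose entries are independent and each distributed as $\xi/\sqrt{m}$, where $\xi$ is standard complex normal, i.e. $\operatorname{Re}\xi$ and $\operatorname{Im}\xi$ are independent normal random variables with mean $0$ and variance $1/2$ (with this normalization its joint eigenvalue density on $\mathbb{C}^m$ is $\frac{m^{m(m+1)/2}}{\pi^m\prod_{k=1}^m k!}\exp\left(-m\sum_{i=1}^m|\zeta_i|^2\right)\prod_{i<j}|\zeta_i-\zeta_j|^2$). Convergence in distribution is that of random elements of the space $\mathbb{C}^{m\times m}$ of $m\times m$ complex matrices. *)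

theory Defs
  imports "HOL-Probability.Probability" "Jordan_Normal_Form.Schur_Decomposition"
begin

definition borel_on :: "'a topology \<Rightarrow> 'a measure" where
  "borel_on T = sigma (topspace T) {S. openin T S}"

text \<open>The type of matrices contains matrices of all sizes and carries no topology in the library.
  The usual topology of $n \times n$ complex matrices is pulled back from the product topology on
  the $n^2$ entries.\<close>

definition mat_topology :: "nat \<Rightarrow> complex mat topology" where
  "mat_topology n =
     pullback_topology (carrier_mat n n) (\<lambda>A. \<lambda>p\<in>{..<n} \<times> {..<n}. A $$ p)
       (product_topology (\<lambda>_. euclidean) ({..<n} \<times> {..<n}))"

definition unitary_group :: "nat \<Rightarrow> complex mat set" where
  "unitary_group n =
     {A \<in> carrier_mat n n. mat_adjoint A * A = 1\<^sub>m n \<and> A * mat_adjoint A = 1\<^sub>m n}"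

definition unitary_borel :: "nat \<Rightarrow> complex mat measure" where
  "unitary_borel n = borel_on (subtopology (mat_topology n) (unitary_group n))"

text \<open>Only left invariance is required; the unitary group is compact, so right invariance and
  uniqueness follow.\<close>

definition normalized_haar_measure :: "nat \<Rightarrow> complex mat measure \<Rightarrow> bool" where
  "normalized_haar_measure n \<mu> \<longleftrightarrow>
     prob_space \<mu> \<and> space \<mu> = unitary_group n \<and> sets \<mu> = sets (unitary_borel n) \<and>
     (\<forall>V\<in>unitary_group n. \<forall>E\<in>sets \<mu>. emeasure \<mu> ((\<lambda>A. V * A) ` E) = emeasure \<mu> E)"

definition haar_unitary_random_matrix ::
  "nat \<Rightarrow> 'a measure \<Rightarrow> ('a \<Rightarrow> complex mat) \<Rightarrow> bool" where
  "haar_unitary_random_matrix n M U \<longleftrightarrow>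
     prob_space M \<and> U \<in> M \<rightarrow>\<^sub>M unitary_borel n \<and>
     normalized_haar_measure n (distr M (unitary_borel n) U)"

definition truncation :: "nat \<Rightarrow> complex mat \<Rightarrow> complex mat" where
  "truncation m A = mat m m (\<lambda>(i, j). A $$ (i, j))"

text \<open>The second argument of the library's normal density is the standard deviation.\<close>

definition standard_complex_normal :: "complex measure" where
  "standard_complex_normal =
     distr (density lborel (normal_density 0 (sqrt (1/2))) \<Otimes>\<^sub>M
            density lborel (normal_density 0 (sqrt (1/2))))
       borel (\<lambda>(x, y). Complex x y)"

definition standard_gaussian_matrix ::
  "nat \<Rightarrow> 'a measure \<Rightarrow> ('a \<Rightarrow> complex mat) \<Rightarrow> bool" where
  "standard_gaussian_matrix m N G \<longleftrightarrow>
     prob_space N \<and> G \<in> N \<rightarrow>\<^sub>M borel_on (mat_topology m) \<and>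
     prob_space.indep_vars N (\<lambda>_. borel) (\<lambda>p \<omega>. G \<omega> $$ p) ({..<m} \<times> {..<m}) \<and>
     (\<forall>p\<in>{..<m} \<times> {..<m}.
        distr N borel (\<lambda>\<omega>. G \<omega> $$ p) =
        distr standard_complex_normal borel (\<lambda>\<xi>. \<xi> / complex_of_real (sqrt (real m))))"

text \<open>The library has convergence in distribution only for real random variables. The conditions on
  the sequence are imposed eventually, so that its first members may be arbitrary.\<close>

definition converges_in_distribution ::
  "'x topology \<Rightarrow> (nat \<Rightarrow> 'a measure) \<Rightarrow> (nat \<Rightarrow> 'a \<Rightarrow> 'x) \<Rightarrow> 'b measure \<Rightarrow> ('b \<Rightarrow> 'x) \<Rightarrow> bool" where
  "converges_in_distribution T M X N Y \<longleftrightarrow>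
     (\<forall>\<^sub>F n in sequentially. prob_space (M n) \<and> X n \<in> M n \<rightarrow>\<^sub>M borel_on T) \<and>
     prob_space N \<and> Y \<in> N \<rightarrow>\<^sub>M borel_on T \<and>
     (\<forall>f. continuous_map T euclideanreal f \<and> bounded (f ` topspace T) \<longrightarrow>
        (\<lambda>n. \<integral>\<omega>. f (X n \<omega>) \<partial>M n) \<longlonglongrightarrow> (\<integral>\<omega>. f (Y \<omega>) \<partial>N))"

end

theory Submission
  imports Defs "HOL-Real_Asymp.Real_Asymp"
begin

text \<open>Characteristic functions converge by a Schwinger--Dyson argument. Let \<open>W\<close> be a real linear form in
  the entries of the truncation. Left invariance under rotations in the plane of rows \<open>i < m\<close> and
  \<open>k \<ge> m\<close>, differentiated at angle zero, trades a factor that is linear in row \<open>i\<close> of the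
  expectation of \<open>cis (t * W)\<close> for a factor that is quadratic in row \<open>k\<close>. Summed over \<open>k\<close>,
  the quadratic factors are constant by orthonormality of the columns, up to the first \<open>m\<close> rows, which
  contribute \<open>O(1/n)\<close>. So the characteristic function satisfies the differential equation of the
  Gaussian one up to a vanishing error. Second moments give tightness, and the passage from
  characteristic functions to bounded continuous test functions goes through Stone--Weierstrass.\<close>

section \<open>Continuity theorem for complex random vectors\<close>

text \<open>The entries of \<open>U\<close> are dependent, and what is assumed about their law is
  invariance, so every identity has to come from a one-parameter family of unitaries. Row
  \<open>k\<close> does not enter \<open>W\<close>. Hence the rotation turns the pair of forms in
  rows \<open>i\<close> and \<open>k\<close>, taken with the same coefficients, by the angle and
  fixes all other summands of \<open>W\<close>. The derivative along a real angle sees only the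
  squared real part of the form in row \<open>k\<close>. Rotations with phases 1 and
  \<open>\<i>\<close> together give its squared modulus, which is the quantity that orthonormality
  can sum. The equation is kept in the unscaled variable. There the O(1/n) from the first rows is
  multiplied by t and divided by 2 (n - m), so the error at t is O(|t| / n^2). Integrating up to t =
  sqrt n leaves O(1/n). All forms are bounded on the unitary group, which justifies differentiation
  under the integral.\<close>

text \<open>Re (cnj a * z) runs through all real linear forms on the complex plane, so the monomials
  are the characters of the real vector space of \<open>I\<close>-indexed vectors. The inductive
  form reduces convergence of expectations to characters.\<close>

inductive trig_poly :: "'i set \<Rightarrow> (('i \<Rightarrow> complex) \<Rightarrow> complex) \<Rightarrow> bool" for I where
  monomial: "trig_poly I (\<lambda>x. c * cis (\<Sum>i\<in>I. Re (cnj (a i) * x i)))"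
| add: "trig_poly I p \<Longrightarrow> trig_poly I q \<Longrightarrow> trig_poly I (\<lambda>x. p x + q x)"

lemma trig_poly_const: "trig_poly I (\<lambda>x. c)"
  using trig_poly.monomial[of I c "\<lambda>_. 0"] by simp

lemma trig_poly_mult_monomial:
  "trig_poly I p \<Longrightarrow> trig_poly I (\<lambda>x. c * cis (\<Sum>i\<in>I. Re (cnj (a i) * x i)) * p x)"
proof (induction rule: trig_poly.induct)
  case (monomial d b)
  have "(\<lambda>x. c * cis (\<Sum>i\<in>I. Re (cnj (a i) * x i)) * (d * cis (\<Sum>i\<in>I. Re (cnj (b i) * x i))))
      = (\<lambda>x. (c * d) * cis (\<Sum>i\<in>I. Re (cnj (a i + b i) * x i)))"
    by (simp add: fun_eq_iff cis_mult[symmetric] sum.distrib algebra_simps)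
  then show ?case using trig_poly.monomial[of I "c * d" "\<lambda>i. a i + b i"] by simp
next
  case (add p q)
  then show ?case using trig_poly.add[OF add.IH] by (simp add: distrib_left)
qed

text \<open>Frequencies of characters add. Closure under products is what makes this class an
  algebra for Stone--Weierstrass.\<close>

lemma trig_poly_mult: "trig_poly I p \<Longrightarrow> trig_poly I q \<Longrightarrow> trig_poly I (\<lambda>x. p x * q x)"
proof (induction rule: trig_poly.induct)
  case (monomial c a)
  then show ?case by (rule trig_poly_mult_monomial)
next
  case (add p1 p2)
  then show ?case using trig_poly.add[OF add.IH] by (simp add: distrib_right)
qed

text \<open>A real \<open>b\<close> selects the real part of the coordinate and an imaginary
  \<open>b\<close> the imaginary part, so one statement serves both.\<close>

lemma trig_poly_sin:
  assumes "finite I" "k \<in> I"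
  shows "trig_poly I (\<lambda>x. complex_of_real (sin (Re (cnj b * x k))))"
proof -
  have *: "trig_poly I (\<lambda>x. d * cis (Re (cnj b * x k)))" for d b
  proof -
    have "(\<Sum>i\<in>I. Re (cnj (if i = k then b else 0) * x i)) = Re (cnj b * x k)" for x :: "'a \<Rightarrow> complex"
      using sum.remove[OF assms, of "\<lambda>i. Re (cnj (if i = k then b else 0) * x i)"] by simp
    then show ?thesis
      using trig_poly.monomial[of I d "\<lambda>i. if i = k then b else 0"] by simp
  qed
  have "complex_of_real (sin t) = 1 / (2*\<i>) * cis t + (-1 / (2*\<i>)) * cis (-t)" for t
    by (simp add: complex_eq_iff)
  then show ?thesis
    using trig_poly.add[OF *[of "1 / (2*\<i>)" b] *[of "-1 / (2*\<i>)" "-b"]] by simp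
qed

lemma trig_poly_bounded_measurable:
  assumes "trig_poly I p" and X: "\<And>i. i \<in> I \<Longrightarrow> (\<lambda>\<omega>. X \<omega> i) \<in> borel_measurable M"
  shows "(\<exists>C. \<forall>x. norm (p x) \<le> C) \<and> (\<lambda>\<omega>. p (X \<omega>)) \<in> borel_measurable M"
  using assms(1)
proof (induction rule: trig_poly.induct)
  case (monomial c a)
  show ?case using X unfolding cis_conv_exp by (auto simp: norm_mult intro!: exI[of _ "norm c"])
next
  case (add p q)
  then obtain C D where "\<forall>x. norm (p x) \<le> C" "\<forall>x. norm (q x) \<le> D" by blast
  then have "\<forall>x. norm (p x + q x) \<le> C + D" by (meson norm_triangle_mono)
  with add show ?case by auto
qed

lemma trig_poly_integrable:
  assumes "prob_space M" "trig_poly I p" "\<And>i. i \<in> I \<Longrightarrow> (\<lambda>\<omega>. X \<omega> i) \<in> borel_measurable M"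
  shows "integrable M (\<lambda>\<omega>. p (X \<omega>))"
proof -
  interpret prob_space M by fact
  show ?thesis
    using trig_poly_bounded_measurable[OF assms(2), of X M] assms(3) integrable_const_bound
    by (metis (mono_tags, lifting) AE_I2)
qed

lemma trig_poly_expectation_tendsto:
  assumes "trig_poly I p"
    and X: "\<forall>\<^sub>F n in sequentially. prob_space (M n) \<and> (\<forall>i\<in>I. (\<lambda>\<omega>. X n \<omega> i) \<in> borel_measurable (M n))"
    and Y: "prob_space N" "\<And>i. i \<in> I \<Longrightarrow> (\<lambda>\<omega>. Y \<omega> i) \<in> borel_measurable N"
    and lim: "\<And>a. (\<lambda>n. \<integral>\<omega>. cis (\<Sum>i\<in>I. Re (cnj (a i) * X n \<omega> i)) \<partial>M n)
          \<longlonglongrightarrow> (\<integral>\<omega>. cis (\<Sum>i\<in>I. Re (cnj (a i) * Y \<omega> i)) \<partial>N)"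
  shows "(\<lambda>n. \<integral>\<omega>. p (X n \<omega>) \<partial>M n) \<longlonglongrightarrow> (\<integral>\<omega>. p (Y \<omega>) \<partial>N)"
  using assms(1)
proof (induction rule: trig_poly.induct)
  case (monomial c a)
  show ?case using tendsto_mult_left[OF lim[of a], of c] by (simp del: Re_complex_div_gt_0 times_complex.sel cnj.sel)
next
  case (add p q)
  have "\<forall>\<^sub>F n in sequentially. (\<integral>\<omega>. p (X n \<omega>) + q (X n \<omega>) \<partial>M n)
      = (\<integral>\<omega>. p (X n \<omega>) \<partial>M n) + (\<integral>\<omega>. q (X n \<omega>) \<partial>M n)"
    using X by eventually_elim
      (intro Bochner_Integration.integral_add trig_poly_integrable[where I=I] add.hyps; simp)
  moreover have "(\<integral>\<omega>. p (Y \<omega>) + q (Y \<omega>) \<partial>N) = (\<integral>\<omega>. p (Y \<omega>) \<partial>N) + (\<integral>\<omega>. q (Y \<omega>) \<partial>N)"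
    by (intro Bochner_Integration.integral_add trig_poly_integrable[where I=I] add.hyps Y)
  ultimately show ?case
    using tendsto_add[OF add.IH] by (simp add: tendsto_cong)
qed

text \<open>Composing with sines rather than approximating on the box directly keeps the trigonometric
  polynomial bounded on the whole space.\<close>

lemma trig_poly_approx:
  fixes f :: "('i::countable \<Rightarrow> complex) \<Rightarrow> real"
  assumes I: "finite I" and f: "continuous_on UNIV f" and B: "\<And>x. \<bar>f x\<bar> \<le> B"
    and R: "R > 0" and e: "e > 0"
  obtains q where "trig_poly I (\<lambda>x. complex_of_real (q x))" "\<And>x. \<bar>q x\<bar> \<le> B + e"
    "\<And>x. (\<And>i. i \<notin> I \<Longrightarrow> x i = 0) \<Longrightarrow> (\<And>i. i \<in> I \<Longrightarrow> norm (x i) \<le> R) \<Longrightarrow> \<bar>f x - q x\<bar> < e"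
proof -
  \<comment> \<open>For |r| \<le> R this puts c * r into [-pi/2, pi/2], where \<open>arcsin\<close>
    inverts \<open>sin\<close>.\<close>
  define c where "c = pi / (2 * R)"
  have c: "c > 0" using R by (simp add: c_def)
  \<comment> \<open>\<open>S\<close> folds the whole space into the compact cube \<open>K\<close>,
    and \<open>T\<close> undoes it on the box of radius \<open>R\<close>. So f o T is approximated
    on \<open>K\<close> and the approximant is pulled back along \<open>S\<close>.\<close>
  define S where "S x i = (if i \<in> I then Complex (sin (c * Re (x i))) (sin (c * Im (x i))) else 0)"
    for x and i
  define T where "T s i = (if i \<in> I then Complex (arcsin (Re (s i)) / c) (arcsin (Im (s i)) / c) else 0)"
    for s and i
  \<comment> \<open>The factors {0} outside \<open>I\<close> make \<open>K\<close> a compact subset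
    of the full function space, and they force two distinct points of \<open>K\<close> to differ at
    an index in \<open>I\<close>.\<close>
  define K :: "('i \<Rightarrow> complex) set"
    where "K = (\<Pi>\<^sub>E i\<in>UNIV. if i \<in> I then cbox (Complex (-1) (-1)) (Complex 1 1) else {0})"
  have K: "s \<in> K \<longleftrightarrow> (\<forall>i. if i \<in> I then \<bar>Re (s i)\<bar> \<le> 1 \<and> \<bar>Im (s i)\<bar> \<le> 1 else s i = 0)" for s
    unfolding K_def PiE_iff by (auto simp: in_cbox_complex_iff abs_le_iff; smt (verit))
  have SK: "S x \<in> K" for x
    by (auto simp: K S_def)
  have "compact K"
  proof -
    have "compactin (product_topology (\<lambda>i. euclidean) UNIV) K"
      unfolding K_def compactin_PiE by (auto intro: compact_cbox)
    then show ?thesis by (simp add: euclidean_product_topology)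
  qed
  have contT: "continuous_on K T"
  proof (intro continuous_on_coordinatewise_then_product)
    fix i
    have co: "continuous_on K (\<lambda>s. s i)"
      by (rule continuous_on_subset[OF continuous_on_product_coordinates subset_UNIV])
    show "continuous_on K (\<lambda>s. T s i)"
    proof (cases "i \<in> I")
      case True
      have bounds: "-1 \<le> Re (s i) \<and> Re (s i) \<le> 1 \<and> -1 \<le> Im (s i) \<and> Im (s i) \<le> 1" if "s \<in> K" for s
        using spec[OF that[unfolded K], of i] True by auto
      then show ?thesis
        using True c unfolding T_def Complex_eq
        by (auto intro!: continuous_intros co dest: bounds)
    qed (simp add: T_def)
  qed
  \<comment> \<open>Stone--Weierstrass is applied to the algebra of those continuous g on
    \<open>K\<close> whose pullback along \<open>S\<close> is a trigonometric polynomial. Real and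
    imaginary parts of coordinates belong to it and separate points.\<close>
  have "\<exists>g. (continuous_on K g \<and> trig_poly I (\<lambda>x. complex_of_real (g (S x)))) \<and> (\<forall>s\<in>K. \<bar>f (T s) - g s\<bar> < e)"
  proof (rule Stone_Weierstrass_HOL[OF \<open>compact K\<close>])
    fix x y :: "'i \<Rightarrow> complex" assume xy: "x \<in> K \<and> y \<in> K \<and> x \<noteq> y"
    then obtain i where i: "x i \<noteq> y i" by blast
    with xy have iI: "i \<in> I" by (metis K)
    have co: "continuous_on K (\<lambda>s. s i)"
      by (rule continuous_on_subset[OF continuous_on_product_coordinates subset_UNIV])
    have "trig_poly I (\<lambda>x. complex_of_real (Re (S x i)))"
      using trig_poly_sin[OF I iI, of "of_real c"] iI by (simp add: S_def)
    moreover have "trig_poly I (\<lambda>x. complex_of_real (Im (S x i)))"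
      using trig_poly_sin[OF I iI, of "\<i> * of_real c"] iI by (simp add: S_def)
    ultimately show "\<exists>g. (continuous_on K g \<and> trig_poly I (\<lambda>x. complex_of_real (g (S x)))) \<and> g x \<noteq> g y"
      using i complex_eqI continuous_on_Re[OF co] continuous_on_Im[OF co] by blast
  next
    show "continuous_on K (\<lambda>s. f (T s))"
      using continuous_on_compose2[OF f contT] by simp
  qed (use e in \<open>auto intro: continuous_intros trig_poly_const trig_poly.add trig_poly_mult\<close>)
  then obtain g where g: "trig_poly I (\<lambda>x. complex_of_real (g (S x)))" "\<And>s. s \<in> K \<Longrightarrow> \<bar>f (T s) - g s\<bar> < e"
    by blast
  show thesis
  proof
    show "trig_poly I (\<lambda>x. complex_of_real (g (S x)))" by fact
    show "\<bar>g (S x)\<bar> \<le> B + e" for x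
      using g(2)[OF SK[of x]] B[of "T (S x)"] by linarith
  next
    fix x :: "'i \<Rightarrow> complex"
    assume x0: "\<And>i. i \<notin> I \<Longrightarrow> x i = 0" and xR: "\<And>i. i \<in> I \<Longrightarrow> norm (x i) \<le> R"
    have arc: "arcsin (sin (c * r)) / c = r" if "\<bar>r\<bar> \<le> R" for r
    proof -
      have "\<bar>c * r\<bar> \<le> c * R" using c that by (simp add: abs_mult)
      also have "c * R = pi / 2" using R by (simp add: c_def)
      finally show ?thesis using c by (subst arcsin_sin) (auto simp: abs_le_iff)
    qed
    have "T (S x) = x"
    proof
      fix i show "T (S x) i = x i"
      proof (cases "i \<in> I")
        case True
        have "\<bar>Re (x i)\<bar> \<le> R" "\<bar>Im (x i)\<bar> \<le> R"
          using xR[OF True] abs_Re_le_cmod[of "x i"] abs_Im_le_cmod[of "x i"] by linarith+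
        then show ?thesis using True by (simp add: T_def S_def arc)
      qed (simp add: T_def x0)
    qed
    then show "\<bar>f x - g (S x)\<bar> < e" using g(2)[OF SK[of x]] by simp
  qed
qed

section \<open>Tightness and the passage to bounded continuous test functions\<close>

lemma (in prob_space) expectation_diff_le:
  fixes g h :: "'a \<Rightarrow> real"
  assumes "g \<in> borel_measurable M" "h \<in> borel_measurable M" "E \<in> events"
    and "\<And>\<omega>. \<bar>g \<omega>\<bar> \<le> B" "\<And>\<omega>. \<bar>h \<omega>\<bar> \<le> B'" "0 \<le> e"
    and "\<And>\<omega>. \<omega> \<in> space M \<Longrightarrow> \<omega> \<notin> E \<Longrightarrow> \<bar>g \<omega> - h \<omega>\<bar> \<le> e"
  shows "\<bar>expectation g - expectation h\<bar> \<le> e + (B + B') * prob E"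
proof -
  have g: "integrable M g" by (rule integrable_const_bound[where B=B]) (use assms in auto)
  have h: "integrable M h" by (rule integrable_const_bound[where B=B']) (use assms in auto)
  have "\<bar>expectation g - expectation h\<bar> = \<bar>expectation (\<lambda>\<omega>. g \<omega> - h \<omega>)\<bar>"
    using g h by simp
  also have "\<dots> \<le> expectation (\<lambda>\<omega>. \<bar>g \<omega> - h \<omega>\<bar>)"
    by (rule integral_abs_bound)
  also have "\<dots> \<le> expectation (\<lambda>\<omega>. e + (B + B') * indicator E \<omega>)"
  proof (rule integral_mono)
    show "\<bar>g \<omega> - h \<omega>\<bar> \<le> e + (B + B') * indicator E \<omega>" if "\<omega> \<in> space M" for \<omega>
      using assms(4,5,7)[of \<omega>] assms(6) that
      by (auto simp: indicator_def; smt (verit))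
    show "integrable M (\<lambda>\<omega>. e + (B + B') * indicator E \<omega>)"
      using \<open>E \<in> events\<close>
      by (intro Bochner_Integration.integrable_add integrable_mult_right) (auto simp: emeasure_eq_measure)
  qed (use g h in auto)
  also have "\<dots> = e + (B + B') * prob E"
    using \<open>E \<in> events\<close> by (subst Bochner_Integration.integral_add) (auto simp: prob_space emeasure_eq_measure)
  finally show ?thesis .
qed

text \<open>The exceptional events decrease to the empty set as the box grows. The form "for all R
  beyond a threshold" lets this be combined with the tightness of a sequence by taking a
  maximum.\<close>

lemma (in prob_space) exists_box:
  fixes Y :: "'a \<Rightarrow> 'i \<Rightarrow> complex"
  assumes "finite I" and Y: "\<And>i. i \<in> I \<Longrightarrow> (\<lambda>\<omega>. Y \<omega> i) \<in> borel_measurable M" and "e > 0"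
  shows "\<exists>R0. \<forall>R\<ge>R0. prob {\<omega> \<in> space M. \<exists>i\<in>I. norm (Y \<omega> i) > R} < e"
proof -
  let ?E = "\<lambda>R. {\<omega> \<in> space M. \<exists>i\<in>I. norm (Y \<omega> i) > R}"
  have [measurable]: "?E R \<in> events" for R
    using Y \<open>finite I\<close> by measurable
  have "(\<lambda>k. prob (?E (real k))) \<longlonglongrightarrow> prob (\<Inter>k. ?E (real k))"
  proof (rule finite_Lim_measure_decseq)
    show "decseq (\<lambda>k. ?E (real k))"
      unfolding decseq_def by (safe, meson le_less_trans of_nat_mono)
  qed auto
  moreover have "(\<Inter>k. ?E (real k)) = {}"
  proof -
    { fix \<omega> assume "\<omega> \<in> (\<Inter>k. ?E (real k))"
      then have *: "\<exists>i\<in>I. norm (Y \<omega> i) > real k" for k by auto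
      obtain k where "real k > (\<Sum>i\<in>I. norm (Y \<omega> i))" using reals_Archimedean2 by blast
      moreover obtain i where "i \<in> I" "norm (Y \<omega> i) > real k" using * by blast
      moreover have "norm (Y \<omega> i) \<le> (\<Sum>i\<in>I. norm (Y \<omega> i))"
        using \<open>finite I\<close> \<open>i \<in> I\<close> by (intro member_le_sum) auto
      ultimately have False by linarith }
    then show ?thesis by blast
  qed
  ultimately have "\<forall>\<^sub>F k in sequentially. prob (?E (real k)) < e"
    using \<open>e > 0\<close> by (intro order_tendstoD(2)) auto
  then obtain k where k: "prob (?E (real k)) < e" by (auto simp: eventually_sequentially)
  show ?thesis
  proof (intro exI allI impI)
    fix R assume "R \<ge> real k"
    then have "prob (?E R) \<le> prob (?E (real k))"
      by (intro finite_measure_mono) (auto, meson le_less_trans)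
    with k show "prob (?E R) < e" by simp
  qed
qed

lemma levy_continuity_complex_vectors:
  fixes f :: "('i::countable \<Rightarrow> complex) \<Rightarrow> real"
  assumes I: "finite I"
    and X: "\<forall>\<^sub>F n in sequentially. prob_space (M n) \<and> (\<forall>i\<in>I. (\<lambda>\<omega>. X n \<omega> i) \<in> borel_measurable (M n))
              \<and> (\<lambda>\<omega>. f (X n \<omega>)) \<in> borel_measurable (M n)"
    and X0: "\<And>n \<omega> i. i \<notin> I \<Longrightarrow> X n \<omega> i = 0"
    and Y: "prob_space N" "\<And>i. i \<in> I \<Longrightarrow> (\<lambda>\<omega>. Y \<omega> i) \<in> borel_measurable N" "(\<lambda>\<omega>. f (Y \<omega>)) \<in> borel_measurable N"
    and Y0: "\<And>\<omega> i. i \<notin> I \<Longrightarrow> Y \<omega> i = 0"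
    and lim: "\<And>a. (\<lambda>n. \<integral>\<omega>. cis (\<Sum>i\<in>I. Re (cnj (a i) * X n \<omega> i)) \<partial>M n)
          \<longlonglongrightarrow> (\<integral>\<omega>. cis (\<Sum>i\<in>I. Re (cnj (a i) * Y \<omega> i)) \<partial>N)"
    and tight: "\<And>e. e > 0 \<Longrightarrow> \<exists>R0. \<forall>R\<ge>R0. \<forall>\<^sub>F n in sequentially.
       measure (M n) {\<omega> \<in> space (M n). \<exists>i\<in>I. norm (X n \<omega> i) > R} < e"
    and f: "continuous_on UNIV f" and B: "\<And>x. \<bar>f x\<bar> \<le> B"
  shows "(\<lambda>n. \<integral>\<omega>. f (X n \<omega>) \<partial>M n) \<longlonglongrightarrow> (\<integral>\<omega>. f (Y \<omega>) \<partial>N)"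
proof (rule tendstoI)
  fix \<epsilon> :: real assume "\<epsilon> > 0"
  have "B \<ge> 0" using B[of undefined] by linarith
  \<comment> \<open>The final triangle inequality costs e + (2 B + e) e at each end and e in the
    middle. With e \<le> 1 the total is at most (5 + 4 B) e, which is below 8 (B + 1) e \<le>
    \<epsilon>.\<close>
  define e where "e = min 1 (\<epsilon> / (8 * (B + 1)))"
  have e: "e > 0" "e \<le> 1" "2 * e + 2 * (2 * B + e) * e < \<epsilon> - e"
  proof -
    show "e > 0" "e \<le> 1" using \<open>\<epsilon> > 0\<close> \<open>B \<ge> 0\<close> by (auto simp: e_def)
    have "e * (8 * (B + 1)) \<le> \<epsilon>" using \<open>B \<ge> 0\<close> 
      by (metis add_nonneg_pos e_def less_numeral_extra(1) min.cobounded2 mult_pos_pos pos_le_divide_eq zero_less_numeral)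
    moreover have "2 * e + 2 * (2 * B + e) * e \<le> 2 * e + 2 * (2 * B + 1) * e"
      using \<open>e > 0\<close> \<open>e \<le> 1\<close> \<open>B \<ge> 0\<close> by (intro add_left_mono mult_right_mono) auto
    moreover have "B * e \<ge> 0" using \<open>e > 0\<close> \<open>B \<ge> 0\<close> by simp
    ultimately show "2 * e + 2 * (2 * B + e) * e < \<epsilon> - e"
      using \<open>e > 0\<close> unfolding distrib_left distrib_right mult.assoc mult.left_commute[of e] mult.commute[of e B]
      by linarith
  qed
  interpret N: prob_space N by fact
  obtain R1 where R1: "\<And>R. R \<ge> R1 \<Longrightarrow> measure N {\<omega> \<in> space N. \<exists>i\<in>I. norm (Y \<omega> i) > R} < e"
    using N.exists_box[OF I _ e(1), of Y] Y(2) by blast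
  obtain R2 where R2: "\<And>R. R \<ge> R2 \<Longrightarrow> \<forall>\<^sub>F n in sequentially.
       measure (M n) {\<omega> \<in> space (M n). \<exists>i\<in>I. norm (X n \<omega> i) > R} < e"
    using tight[OF e(1)] by blast
  define R where "R = max 1 (max R1 R2)"
  have R0: "R > 0" by (simp add: R_def)
  obtain q where q: "trig_poly I (\<lambda>x. complex_of_real (q x))" "\<And>x. \<bar>q x\<bar> \<le> B + e"
    "\<And>x. (\<And>i. i \<notin> I \<Longrightarrow> x i = 0) \<Longrightarrow> (\<And>i. i \<in> I \<Longrightarrow> norm (x i) \<le> R) \<Longrightarrow> \<bar>f x - q x\<bar> < e"
    using trig_poly_approx[OF I f B R0 e(1)] by blast
  \<comment> \<open>Replacing \<open>f\<close> by \<open>q\<close> costs e inside the box and the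
    sum of the sup bounds, B + (B + e), outside it. The local type \<open>'p\<close> is generalized,
    so the fact serves the sample spaces of both \<open>X n\<close> and \<open>Y\<close>.\<close>
  have approx: "\<bar>(\<integral>\<omega>. f (Z \<omega>) \<partial>P) - (\<integral>\<omega>. q (Z \<omega>) \<partial>P)\<bar> \<le> e + (2 * B + e) * e"
    if P: "prob_space P" and Z: "\<And>i. i \<in> I \<Longrightarrow> (\<lambda>\<omega>. Z \<omega> i) \<in> borel_measurable P"
      and fZ: "(\<lambda>\<omega>. f (Z \<omega>)) \<in> borel_measurable P"
      and Z0: "\<And>\<omega> i. i \<notin> I \<Longrightarrow> Z \<omega> i = 0"
      and small: "measure P {\<omega> \<in> space P. \<exists>i\<in>I. norm (Z \<omega> i) > R} < e"
    for P :: "'p measure" and Z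
  proof -
    interpret P: prob_space P by fact
    let ?E = "{\<omega> \<in> space P. \<exists>i\<in>I. norm (Z \<omega> i) > R}"
    have cq: "(\<lambda>\<omega>. complex_of_real (q (Z \<omega>))) \<in> borel_measurable P"
      using trig_poly_bounded_measurable[OF q(1), of Z P] Z by blast
    have qZ: "(\<lambda>\<omega>. q (Z \<omega>)) \<in> borel_measurable P"
      using measurable_compose[OF cq borel_measurable_Re] by simp
    have "\<bar>P.expectation (\<lambda>\<omega>. f (Z \<omega>)) - P.expectation (\<lambda>\<omega>. q (Z \<omega>))\<bar> \<le> e + (B + (B + e)) * P.prob ?E"
    proof (rule P.expectation_diff_le[OF fZ qZ])
      show "?E \<in> P.events" using Z I by measurable
      show "\<bar>f (Z \<omega>) - q (Z \<omega>)\<bar> \<le> e" if "\<omega> \<in> space P" "\<omega> \<notin> ?E" for \<omega>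
        using that q(3)[of "Z \<omega>", OF Z0] by (force simp: not_less intro: less_imp_le)
    qed (use B q e in auto)
    also have "\<dots> \<le> e + (B + (B + e)) * e"
      using small e \<open>B \<ge> 0\<close> by (intro add_left_mono mult_left_mono) auto
    finally show ?thesis by (simp add: algebra_simps)
  qed
  have "(\<lambda>n. \<integral>\<omega>. complex_of_real (q (X n \<omega>)) \<partial>M n) \<longlonglongrightarrow> (\<integral>\<omega>. complex_of_real (q (Y \<omega>)) \<partial>N)"
    by (rule trig_poly_expectation_tendsto[OF q(1)]) (use X Y lim in \<open>auto elim: eventually_mono\<close>)
  then have qlim: "(\<lambda>n. \<integral>\<omega>. q (X n \<omega>) \<partial>M n) \<longlonglongrightarrow> (\<integral>\<omega>. q (Y \<omega>) \<partial>N)"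
    by (simp add: tendsto_of_real_iff)
  have fY: "\<bar>(\<integral>\<omega>. f (Y \<omega>) \<partial>N) - (\<integral>\<omega>. q (Y \<omega>) \<partial>N)\<bar> \<le> e + (2 * B + e) * e"
    by (intro approx Y Y0 R1) (auto simp: R_def)
  from qlim have "\<forall>\<^sub>F n in sequentially. \<bar>(\<integral>\<omega>. q (X n \<omega>) \<partial>M n) - (\<integral>\<omega>. q (Y \<omega>) \<partial>N)\<bar> < e"
    using tendstoD[OF _ e(1)] by (fastforce simp: dist_real_def)
  moreover have "\<forall>\<^sub>F n in sequentially. measure (M n) {\<omega> \<in> space (M n). \<exists>i\<in>I. norm (X n \<omega> i) > R} < e"
    by (rule R2) (simp add: R_def)
  ultimately show "\<forall>\<^sub>F n in sequentially. dist (\<integral>\<omega>. f (X n \<omega>) \<partial>M n) (\<integral>\<omega>. f (Y \<omega>) \<partial>N) < \<epsilon>"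
    using X
  proof eventually_elim
    case (elim n)
    have "\<bar>(\<integral>\<omega>. f (X n \<omega>) \<partial>M n) - (\<integral>\<omega>. q (X n \<omega>) \<partial>M n)\<bar> \<le> e + (2 * B + e) * e"
      using elim X0 by (intro approx) auto
    with elim fY e(3) show ?case by (simp add: dist_real_def abs_if algebra_simps split: if_splits)
  qed
qed

section \<open>Matrix entries, Haar invariance and plane rotations\<close>

lemma topspace_mat_topology [simp]: "topspace (mat_topology n) = carrier_mat n n"
  by (auto simp: mat_topology_def topspace_pullback_topology)

lemma continuous_map_mat_topologyI:
  assumes "\<And>x. x \<in> topspace T \<Longrightarrow> F x \<in> carrier_mat n n"
    and "\<And>i j. i < n \<Longrightarrow> j < n \<Longrightarrow> continuous_map T euclidean (\<lambda>x. F x $$ (i, j))"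
  shows "continuous_map T (mat_topology n) F"
  unfolding mat_topology_def
proof (rule continuous_map_pullback')
  have "continuous_map T (product_topology (\<lambda>_. euclidean) ({..<n} \<times> {..<n}))
      (\<lambda>x. \<lambda>p\<in>{..<n} \<times> {..<n}. F x $$ p)"
    using assms(2) by (auto simp: continuous_map_componentwise)
  then show "continuous_map T (product_topology (\<lambda>_. euclidean) ({..<n} \<times> {..<n}))
      ((\<lambda>A. \<lambda>p\<in>{..<n} \<times> {..<n}. A $$ p) \<circ> F)"
    by (simp add: o_def)
qed (use assms(1) in auto)

lemma continuous_map_mat_entry:
  assumes "i < n" "j < n"
  shows "continuous_map (mat_topology n) euclidean (\<lambda>A. A $$ (i, j))"
proof -
  have "continuous_map (mat_topology n) euclidean
      ((\<lambda>x. x (i, j)) \<circ> (\<lambda>A. \<lambda>p\<in>{..<n} \<times> {..<n}. A $$ p))"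
    unfolding mat_topology_def
    by (intro continuous_map_pullback continuous_map_product_projection) (use assms in auto)
  then show ?thesis using assms by (simp add: o_def)
qed

lemma sets_borel_on: "sets (borel_on T) = sigma_sets (topspace T) {S. openin T S}"
  and space_borel_on [simp]: "space (borel_on T) = topspace T"
proof -
  have "{S. openin T S} \<subseteq> Pow (topspace T)" by (auto dest: openin_subset)
  then show "sets (borel_on T) = sigma_sets (topspace T) {S. openin T S}" "space (borel_on T) = topspace T"
    unfolding borel_on_def by (auto simp: sets_measure_of space_measure_of)
qed

lemma measurable_borel_on:
  assumes "continuous_map S T F"
  shows "F \<in> borel_on S \<rightarrow>\<^sub>M borel_on T"
proof (rule measurable_sigma_sets[OF sets_borel_on])
  show "{S. openin T S} \<subseteq> Pow (topspace T)" by (auto dest: openin_subset)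
  show "F \<in> space (borel_on S) \<rightarrow> topspace T"
    using assms by (auto simp: continuous_map_def)
  fix A assume "A \<in> {S. openin T S}"
  then have "openin S {x \<in> topspace S. F x \<in> A}"
    using assms by (auto simp: continuous_map_def)
  moreover have "F -` A \<inter> space (borel_on S) = {x \<in> topspace S. F x \<in> A}" by auto
  ultimately show "F -` A \<inter> space (borel_on S) \<in> sets (borel_on S)"
    by (simp add: sets_borel_on)
qed

lemma borel_on_euclidean: "borel_on euclidean = borel"
  by (simp add: borel_on_def borel_def)

lemma topspace_unitary [simp]:
  "topspace (subtopology (mat_topology n) (unitary_group n)) = unitary_group n"
  by (subst topspace_subtopology) (auto simp: unitary_group_def)

lemma space_unitary_borel [simp]: "space (unitary_borel n) = unitary_group n"
  by (simp add: unitary_borel_def del: topspace_subtopology)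

lemma unitary_entry_measurable:
  assumes "i < n" "j < n"
  shows "(\<lambda>A. A $$ (i, j)) \<in> borel_measurable (unitary_borel n)"
  using measurable_borel_on[OF continuous_map_from_subtopology[OF continuous_map_mat_entry[OF assms]]]
  by (simp add: unitary_borel_def borel_on_euclidean)

lemma mat_adjoint_carrier: "A \<in> carrier_mat n k \<Longrightarrow> mat_adjoint A \<in> carrier_mat k n"
  unfolding mat_adjoint_def by auto

lemma mat_adjoint_index:
  fixes A :: "complex mat"
  assumes "A \<in> carrier_mat n k" "i < k" "j < n"
  shows "mat_adjoint A $$ (i, j) = cnj (A $$ (j, i))"
  using assms unfolding mat_adjoint_def by (auto simp: mat_of_rows_index)

lemma mat_mult_index:
  assumes "A \<in> carrier_mat n k" "B \<in> carrier_mat k l" "i < n" "j < l"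
  shows "(A * B) $$ (i, j) = (\<Sum>p<k. A $$ (i, p) * B $$ (p, j))"
  using assms by (auto simp: scalar_prod_def lessThan_atLeast0)

lemma mat_adjoint_mult:
  fixes A B :: "complex mat"
  assumes "A \<in> carrier_mat n k" "B \<in> carrier_mat k l"
  shows "mat_adjoint (A * B) = mat_adjoint B * mat_adjoint A"
proof (rule eq_matI)
  note carr = assms mult_carrier_mat[OF assms] mat_adjoint_carrier[OF assms(1)] mat_adjoint_carrier[OF assms(2)]
    mat_adjoint_carrier[OF mult_carrier_mat[OF assms]]
  show "dim_row (mat_adjoint (A * B)) = dim_row (mat_adjoint B * mat_adjoint A)"
    "dim_col (mat_adjoint (A * B)) = dim_col (mat_adjoint B * mat_adjoint A)"
    using carr by auto
  fix i j assume "i < dim_row (mat_adjoint B * mat_adjoint A)" "j < dim_col (mat_adjoint B * mat_adjoint A)"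
  then have ij: "i < l" "j < n" using carr by auto
  have "mat_adjoint (A * B) $$ (i, j) = cnj (\<Sum>p<k. A $$ (j, p) * B $$ (p, i))"
    using ij by (simp add: mat_adjoint_index[OF carr(3)] mat_mult_index[OF assms])
  also have "\<dots> = (\<Sum>p<k. mat_adjoint B $$ (i, p) * mat_adjoint A $$ (p, j))"
    using ij by (simp add: mat_adjoint_index[OF carr(1)] mat_adjoint_index[OF carr(2)] mult.commute)
  also have "\<dots> = (mat_adjoint B * mat_adjoint A) $$ (i, j)"
    using ij by (simp add: mat_mult_index[OF carr(5,4)])
  finally show "mat_adjoint (A * B) $$ (i, j) = (mat_adjoint B * mat_adjoint A) $$ (i, j)" .
qed

lemma mat_adjoint_adjoint:
  fixes A :: "complex mat"
  assumes "A \<in> carrier_mat n k"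
  shows "mat_adjoint (mat_adjoint A) = A"
  using assms mat_adjoint_carrier[OF assms] mat_adjoint_carrier[OF mat_adjoint_carrier[OF assms]]
  by (intro eq_matI) (auto simp: mat_adjoint_index[where n=k and k=n] mat_adjoint_index[OF assms])

lemma unitary_adjoint: "V \<in> unitary_group n \<Longrightarrow> mat_adjoint V \<in> unitary_group n"
  by (auto simp: unitary_group_def mat_adjoint_adjoint mat_adjoint_carrier)

lemma unitary_mult:
  assumes "V \<in> unitary_group n" "A \<in> unitary_group n"
  shows "V * A \<in> unitary_group n"
proof -
  have [simp]: "V \<in> carrier_mat n n" "A \<in> carrier_mat n n"
    "mat_adjoint V \<in> carrier_mat n n" "mat_adjoint A \<in> carrier_mat n n"
    using assms by (auto simp: unitary_group_def mat_adjoint_carrier)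
  have [simp]: "V * A \<in> carrier_mat n n" "mat_adjoint A * mat_adjoint V \<in> carrier_mat n n"
    by (auto intro: mult_carrier_mat[where n=n])
  have "mat_adjoint A * mat_adjoint V * (V * A) = mat_adjoint A * ((mat_adjoint V * V) * A)"
    by (subst (1 2) assoc_mult_mat[of _ n n _ n _ n]) auto
  moreover have "V * A * (mat_adjoint A * mat_adjoint V) = V * ((A * mat_adjoint A) * mat_adjoint V)"
    by (subst (1 2) assoc_mult_mat[of _ n n _ n _ n]) auto
  ultimately show ?thesis
    using assms
    by (simp add: unitary_group_def mat_adjoint_mult[of _ n n _ n] left_mult_one_mat[of _ n n])
qed

lemma unitary_cancel:
  assumes "V \<in> unitary_group n" "A \<in> carrier_mat n n"
  shows "V * (mat_adjoint V * A) = A" "mat_adjoint V * (V * A) = A"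
proof -
  have *: "V \<in> carrier_mat n n" "mat_adjoint V \<in> carrier_mat n n"
    using assms by (auto simp: unitary_group_def mat_adjoint_carrier)
  show "V * (mat_adjoint V * A) = A"
    using assoc_mult_mat[OF * assms(2)] assms by (simp add: unitary_group_def)
  show "mat_adjoint V * (V * A) = A"
    using assoc_mult_mat[OF *(2,1) assms(2)] assms by (simp add: unitary_group_def)
qed

lemma continuous_map_compose_continuous_on_UNIV:
  assumes "continuous_map T euclidean f" "continuous_on UNIV g"
  shows "continuous_map T euclidean (\<lambda>x. g (f x))"
  using continuous_map_compose[OF assms(1), of euclidean g] assms(2) by (simp add: o_def)

lemma unitary_mult_measurable:
  assumes V: "V \<in> unitary_group n"
  shows "(\<lambda>A. V * A) \<in> unitary_borel n \<rightarrow>\<^sub>M unitary_borel n"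
  unfolding unitary_borel_def
proof (rule measurable_borel_on, rule continuous_map_into_subtopology)
  let ?T = "subtopology (mat_topology n) (unitary_group n)"
  have Vc: "V \<in> carrier_mat n n" using V by (auto simp: unitary_group_def)
  show "continuous_map ?T (mat_topology n) (\<lambda>A. V * A)"
  proof (rule continuous_map_mat_topologyI)
    fix i j assume ij: "i < n" "j < n"
    have "continuous_map ?T euclidean (\<lambda>A. \<Sum>p<n. V $$ (i, p) * A $$ (p, j))"
      using ij
      by (intro continuous_map_sum continuous_map_compose_continuous_on_UNIV[where g="\<lambda>z. c * z" for c]
          continuous_map_from_subtopology continuous_map_mat_entry continuous_intros) auto
    then show "continuous_map ?T euclidean (\<lambda>A. (V * A) $$ (i, j))"
      by (rule continuous_map_eq) (use Vc ij in \<open>simp add: unitary_group_def mat_mult_index[of V n n _ n] del: index_mult_mat\<close>)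
  qed (use Vc in \<open>auto simp: unitary_group_def\<close>)
qed (use unitary_mult[OF V] in auto)

text \<open>The definition of Haar measure speaks of images, a pushforward of preimages. The two
  meet because \<open>V\<close> is invertible: the image under \<open>V\<close> of the preimage of
  \<open>E\<close> is \<open>E\<close> itself, so invariance is applied to that preimage.\<close>

lemma haar_distr_mult:
  assumes \<mu>: "normalized_haar_measure n \<mu>" and V: "V \<in> unitary_group n"
  shows "distr \<mu> \<mu> (\<lambda>A. V * A) = \<mu>"
proof -
  have sets: "sets \<mu> = sets (unitary_borel n)" and space: "space \<mu> = unitary_group n"
    and inv: "\<And>V E. V \<in> unitary_group n \<Longrightarrow> E \<in> sets \<mu> \<Longrightarrow> emeasure \<mu> ((\<lambda>A. V * A) ` E) = emeasure \<mu> E"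
    using \<mu> by (auto simp: normalized_haar_measure_def)
  have meas: "(\<lambda>A. V * A) \<in> \<mu> \<rightarrow>\<^sub>M \<mu>"
    using unitary_mult_measurable[OF V] by (simp add: measurable_cong_sets[OF sets sets])
  show ?thesis
  proof (rule measure_eqI)
    fix E assume "E \<in> sets (distr \<mu> \<mu> (\<lambda>A. V * A))"
    then have E: "E \<in> sets \<mu>" by simp
    let ?B = "(\<lambda>A. V * A) -` E \<inter> space \<mu>"
    have EU: "E \<subseteq> unitary_group n" using sets.sets_into_space[OF E] space by simp
    have "(\<lambda>A. V * A) ` ?B = E"
    proof
      show "E \<subseteq> (\<lambda>A. V * A) ` ?B"
      proof
        fix A assume A: "A \<in> E"
        then have "V * (mat_adjoint V * A) = A" "mat_adjoint V * A \<in> unitary_group n"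
          using EU V unitary_cancel(1)[OF V] unitary_mult[OF unitary_adjoint[OF V]]
          by (auto simp: unitary_group_def)
        with A show "A \<in> (\<lambda>A. V * A) ` ?B"
          by (intro image_eqI[of _ _ "mat_adjoint V * A"]) (auto simp: space)
      qed
    qed auto
    then show "emeasure (distr \<mu> \<mu> (\<lambda>A. V * A)) E = emeasure \<mu> E"
      using inv[OF V measurable_sets[OF meas E]] by (simp add: emeasure_distr[OF meas E])
  qed simp
qed

lemma haar_integral_mult:
  fixes h :: "complex mat \<Rightarrow> 'b::{banach, second_countable_topology}"
  assumes \<mu>: "normalized_haar_measure n \<mu>" and V: "V \<in> unitary_group n"
    and h: "h \<in> borel_measurable \<mu>"
  shows "(\<integral>A. h (V * A) \<partial>\<mu>) = (\<integral>A. h A \<partial>\<mu>)"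
proof -
  have sets: "sets \<mu> = sets (unitary_borel n)"
    using \<mu> by (auto simp: normalized_haar_measure_def)
  have meas: "(\<lambda>A. V * A) \<in> \<mu> \<rightarrow>\<^sub>M \<mu>"
    using unitary_mult_measurable[OF V] by (simp add: measurable_cong_sets[OF sets sets])
  show ?thesis
    using integral_distr[OF meas h] by (simp add: haar_distr_mult[OF \<mu> V])
qed

section \<open>Rotations in a coordinate plane and linear forms in one row\<close>

text \<open>The phase \<open>w\<close> decides which real component of row \<open>k\<close> is mixed
  into row \<open>i\<close>. Both w = 1 and w = \<open>\<i>\<close> are used, to recover a squared
  modulus from squared real parts.\<close>

definition plane_rotation :: "nat \<Rightarrow> nat \<Rightarrow> nat \<Rightarrow> complex \<Rightarrow> real \<Rightarrow> complex mat" where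
  "plane_rotation n i k w \<theta> = mat n n (\<lambda>(r, c).
     if r = i then (if c = i then of_real (cos \<theta>) else if c = k then of_real (sin \<theta>) * w else 0)
     else if r = k then (if c = i then - of_real (sin \<theta>) * cnj w else if c = k then of_real (cos \<theta>) else 0)
     else if r = c then 1 else 0)"

lemma plane_rotation_carrier [simp]: "plane_rotation n i k w \<theta> \<in> carrier_mat n n"
  by (simp add: plane_rotation_def)

lemma plane_rotation_mult:
  assumes A: "A \<in> carrier_mat n n" and ik: "i < n" "k < n" "i \<noteq> k" and rc: "r < n" "c < n"
  shows "(plane_rotation n i k w \<theta> * A) $$ (r, c) =
    (if r = i then of_real (cos \<theta>) * A $$ (i, c) + of_real (sin \<theta>) * w * A $$ (k, c)
     else if r = k then - of_real (sin \<theta>) * cnj w * A $$ (i, c) + of_real (cos \<theta>) * A $$ (k, c)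
     else A $$ (r, c))"
proof -
  have "(plane_rotation n i k w \<theta> * A) $$ (r, c) = (\<Sum>p<n. plane_rotation n i k w \<theta> $$ (r, p) * A $$ (p, c))"
    using A rc by (simp add: mat_mult_index[OF plane_rotation_carrier A])
  also have "\<dots> = (\<Sum>p<n. if r = i then
       (if p = i then of_real (cos \<theta>) * A $$ (p, c) else 0) + (if p = k then of_real (sin \<theta>) * w * A $$ (p, c) else 0)
     else if r = k then
       (if p = i then - of_real (sin \<theta>) * cnj w * A $$ (p, c) else 0) + (if p = k then of_real (cos \<theta>) * A $$ (p, c) else 0)
     else (if p = r then A $$ (p, c) else 0))"
    using ik rc by (intro sum.cong) (auto simp: plane_rotation_def)
  also have "\<dots> = (if r = i then of_real (cos \<theta>) * A $$ (i, c) + of_real (sin \<theta>) * w * A $$ (k, c)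
     else if r = k then - of_real (sin \<theta>) * cnj w * A $$ (i, c) + of_real (cos \<theta>) * A $$ (k, c)
     else A $$ (r, c))"
    using ik rc by (simp add: sum.distrib sum.delta)
  finally show ?thesis .
qed

text \<open>The adjoint is the rotation by the opposite angle, so a single product identity, read at
  \<theta> and at -\<theta>, gives both halves of unitarity.\<close>

lemma plane_rotation_unitary:
  assumes ik: "i < n" "k < n" "i \<noteq> k" and w: "norm w = 1"
  shows "plane_rotation n i k w \<theta> \<in> unitary_group n"
proof -
  have ww: "w * cnj w = 1" using w by (simp add: complex_norm_square[symmetric])
  have trig: "complex_of_real (cos t) * complex_of_real (cos t) + complex_of_real (sin t) * complex_of_real (sin t) = 1" for t
    using sin_cos_squared_add3[of t] by (metis of_real_1 of_real_add of_real_mult)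
  note index = plane_rotation_def index_mat case_prod_conv
  have adj: "mat_adjoint (plane_rotation n i k w \<theta>) = plane_rotation n i k w (- \<theta>)" for \<theta>
  proof (rule eq_matI)
    fix r c assume "r < dim_row (plane_rotation n i k w (- \<theta>))" "c < dim_col (plane_rotation n i k w (- \<theta>))"
    then have rc: "r < n" "c < n" by (auto simp: plane_rotation_def)
    show "mat_adjoint (plane_rotation n i k w \<theta>) $$ (r, c) = plane_rotation n i k w (- \<theta>) $$ (r, c)"
      unfolding mat_adjoint_index[OF plane_rotation_carrier rc] using rc ik
      by (simp add: index)
  qed (use mat_adjoint_carrier[OF plane_rotation_carrier, of n i k w \<theta>] plane_rotation_carrier[of n i k w "-\<theta>"]
      in \<open>simp_all only: carrier_matD\<close>)
  have inv: "plane_rotation n i k w \<theta> * plane_rotation n i k w (- \<theta>) = 1\<^sub>m n" for \<theta>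
  proof (rule eq_matI)
    fix r c assume "r < dim_row (1\<^sub>m n)" "c < dim_col (1\<^sub>m n)"
    then have rc: "r < n" "c < n" by auto
    let ?C = "complex_of_real (cos \<theta>)" and ?S = "complex_of_real (sin \<theta>)"
    have "?C * ?C + ?S * w * (?S * cnj w) = ?C * ?C + ?S * ?S * (w * cnj w)"
      "?C * ?C + ?S * cnj w * (?S * w) = ?C * ?C + ?S * ?S * (w * cnj w)"
      by (simp_all only: mult_ac)
    then have diag: "?C * ?C + ?S * w * (?S * cnj w) = 1" "?S * cnj w * (?S * w) + ?C * ?C = 1"
      by (simp_all add: ww trig add.commute)
    show "(plane_rotation n i k w \<theta> * plane_rotation n i k w (- \<theta>)) $$ (r, c) = 1\<^sub>m n $$ (r, c)"
      unfolding plane_rotation_mult[OF plane_rotation_carrier ik rc]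
      using ik rc diag by (simp add: index mult.commute)
  qed (auto simp: plane_rotation_def)
  show ?thesis
    using inv[of \<theta>] inv[of "-\<theta>"] by (auto simp: unitary_group_def adj)
qed

text \<open>Only the first \<open>m\<close> columns enter, but \<open>k\<close> may be any row of
  the full matrix: rows below the truncation are the partners in the rotations.\<close>

definition row_form :: "nat \<Rightarrow> (nat \<Rightarrow> complex) \<Rightarrow> nat \<Rightarrow> complex mat \<Rightarrow> complex" where
  "row_form m a k A = (\<Sum>j<m. cnj (a j) * A $$ (k, j))"

lemma unitary_columns_orthonormal:
  assumes A: "A \<in> unitary_group n" and jl: "j < n" "l < n"
  shows "(\<Sum>k<n. A $$ (k, j) * cnj (A $$ (k, l))) = (if j = l then 1 else 0)"
proof -
  have Ac: "A \<in> carrier_mat n n" and AA: "mat_adjoint A * A = 1\<^sub>m n" using A by (auto simp: unitary_group_def)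
  have "(mat_adjoint A * A) $$ (l, j) = (\<Sum>k<n. cnj (A $$ (k, l)) * A $$ (k, j))"
    using jl Ac by (simp add: mat_mult_index[OF mat_adjoint_carrier[OF Ac] Ac] mat_adjoint_index[OF Ac])
  then show ?thesis using jl by (auto simp: AA mult.commute)
qed

text \<open>The forms in all rows are the coordinates of \<open>A\<close> applied to the conjugate
  of \<open>a\<close>, padded by zeros, and \<open>A\<close> is an isometry. The computation expands
  the squares and uses orthonormal columns.\<close>

lemma sum_norm_row_form:
  assumes A: "A \<in> unitary_group n" and "m \<le> n"
  shows "(\<Sum>k<n. (norm (row_form m a k A))\<^sup>2) = (\<Sum>j<m. (norm (a j))\<^sup>2)"
proof -
  have "complex_of_real (\<Sum>k<n. (norm (row_form m a k A))\<^sup>2) = (\<Sum>k<n. row_form m a k A * cnj (row_form m a k A))"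
    unfolding of_real_sum complex_norm_square ..
  also have "\<dots> = (\<Sum>k<n. \<Sum>j<m. \<Sum>l<m. cnj (a j) * a l * (A $$ (k, j) * cnj (A $$ (k, l))))"
    unfolding row_form_def cnj_sum sum_product
    by (intro sum.cong refl) (simp add: mult_ac)
  also have "\<dots> = (\<Sum>j<m. \<Sum>l<m. \<Sum>k<n. cnj (a j) * a l * (A $$ (k, j) * cnj (A $$ (k, l))))"
    by (subst sum.swap) (intro sum.cong refl sum.swap)
  also have "\<dots> = (\<Sum>j<m. \<Sum>l<m. cnj (a j) * a l * (if j = l then 1 else 0))"
    unfolding sum_distrib_left[symmetric]
    using \<open>m \<le> n\<close> by (intro sum.cong refl) (subst unitary_columns_orthonormal[OF A], auto)
  also have "\<dots> = (\<Sum>j<m. cnj (a j) * a j)"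
    by (intro sum.cong refl) (simp add: if_distrib[of "\<lambda>x. _ * x"] sum.delta cong: if_cong)
  also have "\<dots> = complex_of_real (\<Sum>j<m. (norm (a j))\<^sup>2)"
    unfolding of_real_sum complex_norm_square by (simp add: mult.commute)
  finally show ?thesis unfolding of_real_eq_iff .
qed

lemma norm_row_form_le:
  assumes A: "A \<in> unitary_group n" and "m \<le> n" "k < n"
  shows "(norm (row_form m a k A))\<^sup>2 \<le> (\<Sum>j<m. (norm (a j))\<^sup>2)"
  using sum_norm_row_form[OF A \<open>m \<le> n\<close>, of a] \<open>k < n\<close>
    member_le_sum[of k "{..<n}" "\<lambda>k. (norm (row_form m a k A))\<^sup>2"] by simp

lemma row_form_plane_rotation:
  assumes "A \<in> carrier_mat n n" "i < n" "k < n" "i \<noteq> k" "r < n" "m \<le> n"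
  shows "row_form m a r (plane_rotation n i k w \<theta> * A) =
    (if r = i then of_real (cos \<theta>) * row_form m a i A + of_real (sin \<theta>) * (w * row_form m a k A)
     else if r = k then - of_real (sin \<theta>) * (cnj w * row_form m a i A) + of_real (cos \<theta>) * row_form m a k A
     else row_form m a r A)"
proof -
  have "row_form m a r (plane_rotation n i k w \<theta> * A) = (\<Sum>j<m. cnj (a j) *
    (if r = i then of_real (cos \<theta>) * A $$ (i, j) + of_real (sin \<theta>) * w * A $$ (k, j)
     else if r = k then - of_real (sin \<theta>) * cnj w * A $$ (i, j) + of_real (cos \<theta>) * A $$ (k, j)
     else A $$ (r, j)))"
    unfolding row_form_def using assms by (intro sum.cong refl) (subst plane_rotation_mult, auto)
  then show ?thesis
    by (simp add: row_form_def sum_distrib_left distrib_left sum.distrib sum_subtractf right_diff_distrib sum_negf mult_ac)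
qed

lemma row_form_measurable:
  assumes "k < n" "m \<le> n"
  shows "row_form m a k \<in> borel_measurable (unitary_borel n)"
proof -
  have "(\<lambda>A. \<Sum>j<m. cnj (a j) * A $$ (k, j)) \<in> borel_measurable (unitary_borel n)"
    using assms by (intro borel_measurable_sum borel_measurable_times borel_measurable_const unitary_entry_measurable) auto
  then show ?thesis by (simp add: row_form_def[abs_def])
qed

section \<open>Integration by parts\<close>

lemma onorm_scaleR_le: "norm v \<le> B \<Longrightarrow> onorm (\<lambda>h::real. h *\<^sub>R v) \<le> B"
  by (intro onorm_le) (simp add: mult.commute[of B] mult_left_mono)

text \<open>Dominated convergence for the normalized remainder of the difference quotient. The
  uniform bound on the derivative supplies the dominating constant through the mean value
  inequality.\<close>

lemma (in prob_space) has_vector_derivative_integral: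
  fixes F :: "real \<Rightarrow> 'a \<Rightarrow> complex"
  assumes F: "\<And>t. integrable M (F t)" and F': "F' t \<in> borel_measurable M"
    and deriv: "\<And>t \<omega>. \<omega> \<in> space M \<Longrightarrow> ((\<lambda>t. F t \<omega>) has_vector_derivative F' t \<omega>) (at t)"
    and bound: "\<And>t \<omega>. \<omega> \<in> space M \<Longrightarrow> norm (F' t \<omega>) \<le> B"
  shows "((\<lambda>t. \<integral>\<omega>. F t \<omega> \<partial>M) has_vector_derivative (\<integral>\<omega>. F' t \<omega> \<partial>M)) (at t)"
proof -
  have intF': "integrable M (F' t)"
    by (rule integrable_const_bound[where B=B]) (use F' bound in auto)
  \<comment> \<open>At s = t the quotient is 0 by the convention for division by zero, so the
    estimates on \<open>q\<close> hold for every s.\<close>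
  define q where "q s \<omega> = norm (F s \<omega> - F t \<omega> - (s - t) *\<^sub>R F' t \<omega>) / \<bar>s - t\<bar>" for s \<omega>
  have intq: "integrable M (q s)" for s
    unfolding q_def using F intF'
    by (intro integrable_divide integrable_norm Bochner_Integration.integrable_diff) auto
  have lip: "norm (F s \<omega> - F t \<omega>) \<le> B * \<bar>s - t\<bar>" if "\<omega> \<in> space M" for s \<omega>
  proof -
    have "norm (F s \<omega> - F t \<omega>) \<le> B * norm (s - t)"
    proof (rule differentiable_bound[where S=UNIV and f'="\<lambda>x h. h *\<^sub>R F' x \<omega>"])
      show "((\<lambda>s. F s \<omega>) has_derivative (\<lambda>h. h *\<^sub>R F' x \<omega>)) (at x within UNIV)" for x
        using deriv[OF that, of x] by (simp add: has_vector_derivative_def)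
      show "onorm (\<lambda>h. h *\<^sub>R F' x \<omega>) \<le> B" for x
        by (rule onorm_scaleR_le[OF bound[OF that]])
    qed auto
    then show ?thesis by simp
  qed
  have qB: "\<bar>q s \<omega>\<bar> \<le> 2 * B" if "\<omega> \<in> space M" for s \<omega>
  proof -
    have "norm (F s \<omega> - F t \<omega> - (s - t) *\<^sub>R F' t \<omega>) \<le> norm (F s \<omega> - F t \<omega>) + \<bar>s - t\<bar> * norm (F' t \<omega>)"
      by (metis norm_triangle_ineq4 norm_scaleR)
    also have "\<dots> \<le> B * \<bar>s - t\<bar> + \<bar>s - t\<bar> * B"
      by (intro add_mono lip[OF that] mult_left_mono bound[OF that]) auto
    finally show ?thesis
      using order_trans[OF norm_ge_zero bound[OF that]]
      by (auto simp: q_def divide_le_eq)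
  qed
  \<comment> \<open>Dominated convergence is stated for sequences, hence the detour through
    sequences tending to \<open>t\<close> and avoiding it.\<close>
  have lim0: "((\<lambda>s. \<integral>\<omega>. q s \<omega> \<partial>M) \<longlongrightarrow> 0) (at t)"
    unfolding tendsto_at_iff_sequentially
  proof (intro allI impI)
    fix X :: "nat \<Rightarrow> real" assume X: "\<forall>i. X i \<in> UNIV - {t}" "X \<longlonglongrightarrow> t"
    have "(\<lambda>i. \<integral>\<omega>. q (X i) \<omega> \<partial>M) \<longlonglongrightarrow> (\<integral>\<omega>. 0 \<partial>M)"
    proof (rule integral_dominated_convergence[where w="\<lambda>_. 2 * B"])
      show "AE \<omega> in M. (\<lambda>i. q (X i) \<omega>) \<longlonglongrightarrow> 0"
      proof (rule AE_I2)
        fix \<omega> assume "\<omega> \<in> space M"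
        then have "((\<lambda>s. q s \<omega>) \<longlongrightarrow> 0) (at t)"
          using deriv[of \<omega> t] by (simp add: q_def has_vector_derivative_def has_derivative_iff_norm)
        then show "(\<lambda>i. q (X i) \<omega>) \<longlonglongrightarrow> 0"
          using X by (auto simp: tendsto_at_iff_sequentially o_def)
      qed
      show "q (X i) \<in> borel_measurable M" for i using intq by auto
    qed (use qB in auto)
    then show "((\<lambda>s. \<integral>\<omega>. q s \<omega> \<partial>M) \<circ> X) \<longlonglongrightarrow> 0" by (simp add: o_def)
  qed
  have "((\<lambda>s. norm ((\<integral>\<omega>. F s \<omega> \<partial>M) - (\<integral>\<omega>. F t \<omega> \<partial>M) - (s - t) *\<^sub>R (\<integral>\<omega>. F' t \<omega> \<partial>M)) / norm (s - t)) \<longlongrightarrow> 0) (at t)"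
  proof (rule tendsto_sandwich[OF _ _ tendsto_const lim0])
    show "\<forall>\<^sub>F s in at t. norm ((\<integral>\<omega>. F s \<omega> \<partial>M) - (\<integral>\<omega>. F t \<omega> \<partial>M) - (s - t) *\<^sub>R (\<integral>\<omega>. F' t \<omega> \<partial>M)) / norm (s - t)
        \<le> (\<integral>\<omega>. q s \<omega> \<partial>M)"
    proof (rule always_eventually, rule allI)
      fix s
      have "(\<integral>\<omega>. F s \<omega> \<partial>M) - (\<integral>\<omega>. F t \<omega> \<partial>M) - (s - t) *\<^sub>R (\<integral>\<omega>. F' t \<omega> \<partial>M)
          = (\<integral>\<omega>. F s \<omega> - F t \<omega> - (s - t) *\<^sub>R F' t \<omega> \<partial>M)"
        using F intF' by simp
      also have "norm \<dots> \<le> (\<integral>\<omega>. norm (F s \<omega> - F t \<omega> - (s - t) *\<^sub>R F' t \<omega>) \<partial>M)"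
        by (rule integral_norm_bound)
      finally show "norm ((\<integral>\<omega>. F s \<omega> \<partial>M) - (\<integral>\<omega>. F t \<omega> \<partial>M) - (s - t) *\<^sub>R (\<integral>\<omega>. F' t \<omega> \<partial>M)) / norm (s - t)
          \<le> (\<integral>\<omega>. q s \<omega> \<partial>M)"
        by (simp add: q_def divide_right_mono)
    qed
  qed auto
  then show ?thesis
    by (simp add: has_vector_derivative_def has_derivative_iff_norm bounded_linear_scaleR_left)
qed

text \<open>Differentiating the invariance under rotations at angle zero.\<close>

lemma (in prob_space) rotation_integration_by_parts:
  fixes x y b :: "'a \<Rightarrow> real" and \<tau> :: real
  assumes [measurable]: "x \<in> borel_measurable M" "y \<in> borel_measurable M" "b \<in> borel_measurable M"
    and bd: "\<And>\<omega>. \<omega> \<in> space M \<Longrightarrow> \<bar>x \<omega>\<bar> \<le> C" "\<And>\<omega>. \<omega> \<in> space M \<Longrightarrow> \<bar>y \<omega>\<bar> \<le> C"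
    and inv: "\<And>\<theta>. (\<integral>\<omega>. of_real (cos \<theta> * y \<omega> - sin \<theta> * x \<omega>) *
        cis (\<tau> * (b \<omega> + cos \<theta> * x \<omega> + sin \<theta> * y \<omega>)) \<partial>M) = K"
  shows "(\<integral>\<omega>. of_real (x \<omega>) * cis (\<tau> * (b \<omega> + x \<omega>)) \<partial>M)
    = \<i> * of_real \<tau> * (\<integral>\<omega>. of_real ((y \<omega>)\<^sup>2) * cis (\<tau> * (b \<omega> + x \<omega>)) \<partial>M)"
proof -
  \<comment> \<open>\<open>H\<close> is the rotated \<open>x\<close> and \<open>L\<close> the
    rotated \<open>y\<close>. In the angle, \<open>H\<close> has derivative \<open>L\<close> and
    \<open>L\<close> has derivative - \<open>H\<close>; at angle zero they are \<open>x\<close> and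
    \<open>y\<close>.\<close>
  define L where "L \<theta> \<omega> = cos \<theta> * y \<omega> - sin \<theta> * x \<omega>" for \<theta> \<omega>
  define H where "H \<theta> \<omega> = cos \<theta> * x \<omega> + sin \<theta> * y \<omega>" for \<theta> \<omega>
  have [measurable]: "L \<theta> \<in> borel_measurable M" "H \<theta> \<in> borel_measurable M" for \<theta>
    unfolding L_def H_def by measurable
  have mcis: "(\<lambda>\<omega>. cis (\<tau> * (b \<omega> + g \<omega>))) \<in> borel_measurable M" if [measurable]: "g \<in> borel_measurable M" for g
    unfolding cis_conv_exp by measurable
  define F where "F \<theta> \<omega> = of_real (L \<theta> \<omega>) * cis (\<tau> * (b \<omega> + H \<theta> \<omega>))" for \<theta> \<omega>
  define F' where "F' \<theta> \<omega> = (of_real (- H \<theta> \<omega>) + \<i> * of_real (\<tau> * (L \<theta> \<omega>)\<^sup>2)) * cis (\<tau> * (b \<omega> + H \<theta> \<omega>))" for \<theta> \<omega>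
  have LH: "\<bar>L \<theta> \<omega>\<bar> \<le> 2 * C" "\<bar>H \<theta> \<omega>\<bar> \<le> 2 * C" if "\<omega> \<in> space M" for \<theta> \<omega>
  proof -
    have *: "\<bar>u * z\<bar> \<le> C" if "\<bar>u\<bar> \<le> 1" "\<bar>z\<bar> \<le> C" for u z :: real
      using mult_mono[OF that] by (simp add: abs_mult)
    show "\<bar>L \<theta> \<omega>\<bar> \<le> 2 * C" "\<bar>H \<theta> \<omega>\<bar> \<le> 2 * C"
      using *[OF abs_cos_le_one[of \<theta>] bd(1)[OF that]] *[OF abs_cos_le_one[of \<theta>] bd(2)[OF that]]
        *[OF abs_sin_le_one[of \<theta>] bd(1)[OF that]] *[OF abs_sin_le_one[of \<theta>] bd(2)[OF that]]
      unfolding L_def H_def by linarith+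
  qed
  have mF: "F \<theta> \<in> borel_measurable M" for \<theta>
    unfolding F_def by (intro borel_measurable_times mcis) auto
  have mF': "F' \<theta> \<in> borel_measurable M" for \<theta>
    unfolding F'_def by (intro borel_measurable_times mcis) auto
  have intF: "integrable M (F \<theta>)" for \<theta>
    by (rule integrable_const_bound[where B="2 * C"]) (use mF LH in \<open>auto simp: F_def norm_mult\<close>)
  have deriv: "((\<lambda>\<theta>. F \<theta> \<omega>) has_vector_derivative F' \<theta> \<omega>) (at \<theta>)" for \<theta> \<omega>
  proof -
    have dL: "((\<lambda>\<theta>. L \<theta> \<omega>) has_real_derivative - H \<theta> \<omega>) (at \<theta>)"
      unfolding L_def H_def
      by (auto intro!: derivative_eq_intros)
    have dH: "((\<lambda>\<theta>. H \<theta> \<omega>) has_real_derivative L \<theta> \<omega>) (at \<theta>)"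
      unfolding L_def H_def
      by (auto intro!: derivative_eq_intros)
    have dc: "((\<lambda>\<theta>. cis (\<tau> * (b \<omega> + H \<theta> \<omega>))) has_vector_derivative
        (\<tau> * L \<theta> \<omega>) *\<^sub>R (\<i> * cis (\<tau> * (b \<omega> + H \<theta> \<omega>)))) (at \<theta>)"
      using dH unfolding has_vector_derivative_def has_field_derivative_def
      by (auto intro!: derivative_eq_intros simp: algebra_simps)
    show ?thesis
      using has_vector_derivative_mult[OF has_vector_derivative_of_real[OF dL, where 'a=complex] dc]
      by (simp add: F_def F'_def algebra_simps scaleR_conv_of_real power2_eq_square)
  qed
  have bound: "norm (F' \<theta> \<omega>) \<le> 2 * C + \<bar>\<tau>\<bar> * (2 * C)\<^sup>2" if "\<omega> \<in> space M" for \<theta> \<omega>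
  proof -
    have "norm (F' \<theta> \<omega>) \<le> \<bar>H \<theta> \<omega>\<bar> + \<bar>\<tau>\<bar> * (L \<theta> \<omega>)\<^sup>2"
      unfolding F'_def norm_mult norm_cis mult_1_right
      by (rule order_trans[OF norm_triangle_ineq]) (simp add: norm_mult norm_power abs_mult)
    also have "\<dots> \<le> 2 * C + \<bar>\<tau>\<bar> * (2 * C)\<^sup>2"
      using LH(2)[OF that, of \<theta>] power_mono[OF LH(1)[OF that, of \<theta>] abs_ge_zero, of 2]
      by (intro add_mono mult_left_mono) auto
    finally show ?thesis .
  qed
  have "((\<lambda>\<theta>. \<integral>\<omega>. F \<theta> \<omega> \<partial>M) has_vector_derivative (\<integral>\<omega>. F' 0 \<omega> \<partial>M)) (at 0)"
    by (rule has_vector_derivative_integral[OF intF mF' deriv bound])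
  moreover have "(\<lambda>\<theta>. \<integral>\<omega>. F \<theta> \<omega> \<partial>M) = (\<lambda>_. K)"
    using inv by (simp add: F_def L_def H_def add.assoc)
  \<comment> \<open>By invariance the integral is the constant \<open>K\<close>, so its derivative
    vanishes. At angle zero differentiating the factor \<open>L\<close> gives the term with
    \<open>x\<close>, and differentiating the exponent gives the term with y^2.\<close>
  ultimately have "((\<lambda>_::real. K) has_vector_derivative (\<integral>\<omega>. F' 0 \<omega> \<partial>M)) (at 0)" by simp
  then have "(\<integral>\<omega>. F' 0 \<omega> \<partial>M) = 0"
    using has_vector_derivative_const vector_derivative_at by metis
  moreover have "F' 0 \<omega> = \<i> * of_real \<tau> * (of_real ((y \<omega>)\<^sup>2) * cis (\<tau> * (b \<omega> + x \<omega>)))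
      - of_real (x \<omega>) * cis (\<tau> * (b \<omega> + x \<omega>))" for \<omega>
    by (simp add: F'_def L_def H_def algebra_simps)
  moreover have "integrable M (\<lambda>\<omega>. of_real ((y \<omega>)\<^sup>2) * cis (\<tau> * (b \<omega> + x \<omega>)))"
  proof (rule integrable_const_bound[where B="C\<^sup>2"])
    show "(\<lambda>\<omega>. of_real ((y \<omega>)\<^sup>2) * cis (\<tau> * (b \<omega> + x \<omega>))) \<in> borel_measurable M"
      by (intro borel_measurable_times mcis) auto
  qed (use power_mono[OF bd(2) abs_ge_zero, of _ 2] in \<open>auto simp: norm_mult norm_power\<close>)
  moreover have "integrable M (\<lambda>\<omega>. of_real (x \<omega>) * cis (\<tau> * (b \<omega> + x \<omega>)))"
  proof (rule integrable_const_bound[where B=C])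
    show "(\<lambda>\<omega>. of_real (x \<omega>) * cis (\<tau> * (b \<omega> + x \<omega>))) \<in> borel_measurable M"
      by (intro borel_measurable_times mcis) auto
  qed (use bd(1) in \<open>auto simp: norm_mult\<close>)
  ultimately show ?thesis by simp
qed

text \<open>The integrating factor exp (\<beta> t^2) turns the Gaussian solution into a constant, so
  the mean value inequality bounds the deviation. Multiplying back cancels the factor at
  \<open>T\<close>, and the bound is free of \<beta>. An error linear in |t| produces the T^2, which
  suits T = sqrt n.\<close>

lemma gaussian_ode_bound:
  fixes \<phi> \<phi>' :: "real \<Rightarrow> complex"
  assumes deriv: "\<And>t. (\<phi> has_vector_derivative \<phi>' t) (at t)" and "\<phi> 0 = 1"
    and T: "T \<ge> 0" and \<beta>: "\<beta> \<ge> 0"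
    and le: "\<And>t. norm (\<phi>' t + of_real (2 * \<beta> * t) * \<phi> t) \<le> \<epsilon> * \<bar>t\<bar>"
  shows "norm (\<phi> T - of_real (exp (- \<beta> * T\<^sup>2))) \<le> \<epsilon> * T\<^sup>2"
proof -
  define \<psi> where "\<psi> t = of_real (exp (\<beta> * t\<^sup>2)) * \<phi> t" for t
  have \<epsilon>: "\<epsilon> \<ge> 0" using order_trans[OF norm_ge_zero le[of 1]] by simp
  have d: "(\<psi> has_vector_derivative of_real (exp (\<beta> * t\<^sup>2)) * (\<phi>' t + of_real (2 * \<beta> * t) * \<phi> t)) (at t)" for t
  proof -
    have "((\<lambda>t. exp (\<beta> * t\<^sup>2)) has_real_derivative exp (\<beta> * t\<^sup>2) * (2 * \<beta> * t)) (at t)"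
      by (auto intro!: derivative_eq_intros)
    from has_vector_derivative_mult[OF has_vector_derivative_of_real[OF this, where 'a=complex] deriv[of t]]
    show ?thesis by (simp add: \<psi>_def[abs_def] algebra_simps)
  qed
  have "norm (\<psi> T - \<psi> 0) \<le> (exp (\<beta> * T\<^sup>2) * (\<epsilon> * T)) * norm (T - 0)"
  proof (rule differentiable_bound[where S="{0..T}"
        and f'="\<lambda>t h. h *\<^sub>R (of_real (exp (\<beta> * t\<^sup>2)) * (\<phi>' t + of_real (2 * \<beta> * t) * \<phi> t))"])
    fix t assume t: "t \<in> {0..T}"
    show "(\<psi> has_derivative (\<lambda>h. h *\<^sub>R (of_real (exp (\<beta> * t\<^sup>2)) * (\<phi>' t + of_real (2 * \<beta> * t) * \<phi> t)))) (at t within {0..T})"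
      using d[of t] unfolding has_vector_derivative_def by (rule has_derivative_at_withinI)
    have "norm (of_real (exp (\<beta> * t\<^sup>2)) * (\<phi>' t + of_real (2 * \<beta> * t) * \<phi> t)) \<le> exp (\<beta> * t\<^sup>2) * (\<epsilon> * \<bar>t\<bar>)"
      unfolding norm_mult norm_of_real abs_exp_cancel by (intro mult_left_mono le) auto
    also have "\<dots> \<le> exp (\<beta> * T\<^sup>2) * (\<epsilon> * T)"
      using t \<beta> \<epsilon> by (intro mult_mono) (auto intro!: mult_left_mono power_mono)
    finally have b: "norm (of_real (exp (\<beta> * t\<^sup>2)) * (\<phi>' t + of_real (2 * \<beta> * t) * \<phi> t)) \<le> exp (\<beta> * T\<^sup>2) * (\<epsilon> * T)" .
    show "onorm (\<lambda>h. h *\<^sub>R (of_real (exp (\<beta> * t\<^sup>2)) * (\<phi>' t + of_real (2 * \<beta> * t) * \<phi> t))) \<le> exp (\<beta> * T\<^sup>2) * (\<epsilon> * T)"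
      by (rule onorm_scaleR_le[OF b])
  qed (use T in auto)
  then have le': "norm (\<psi> T - 1) \<le> exp (\<beta> * T\<^sup>2) * (\<epsilon> * T\<^sup>2)"
    using T \<open>\<phi> 0 = 1\<close> by (simp add: \<psi>_def power2_eq_square mult.assoc)
  have "exp (- \<beta> * T\<^sup>2) * exp (\<beta> * T\<^sup>2) = (1::real)" by (simp add: exp_minus)
  then have e: "complex_of_real (exp (- \<beta> * T\<^sup>2)) * of_real (exp (\<beta> * T\<^sup>2)) = 1"
    by (metis of_real_1 of_real_mult)
  then have "\<phi> T - of_real (exp (- \<beta> * T\<^sup>2)) = of_real (exp (- \<beta> * T\<^sup>2)) * (\<psi> T - 1)"
    by (simp add: \<psi>_def right_diff_distrib mult.assoc[symmetric])
  then have "norm (\<phi> T - of_real (exp (- \<beta> * T\<^sup>2))) = exp (- \<beta> * T\<^sup>2) * norm (\<psi> T - 1)"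
    by (simp add: norm_mult)
  also have "\<dots> \<le> exp (- \<beta> * T\<^sup>2) * (exp (\<beta> * T\<^sup>2) * (\<epsilon> * T\<^sup>2))"
    by (intro mult_left_mono le') auto
  also have "\<dots> = \<epsilon> * T\<^sup>2" by (simp add: exp_minus)
  finally show ?thesis .
qed

section \<open>Characteristic function of the truncation\<close>

text \<open>The analysis takes place on the law of the random matrix, with the unitary group itself
  as sample space. The original sample spaces enter only through the pushforward.\<close>

locale haar_unitary = prob_space \<mu> for n :: nat and \<mu> :: "complex mat measure" +
  assumes haar: "normalized_haar_measure n \<mu>"
begin

lemma sets_eq: "sets \<mu> = sets (unitary_borel n)"
  and space_eq: "space \<mu> = unitary_group n"
  using haar by (auto simp: normalized_haar_measure_def)

lemma row_form_borel:
  "k < n \<Longrightarrow> m \<le> n \<Longrightarrow> row_form m a k \<in> borel_measurable \<mu>"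
  using row_form_measurable by (simp add: measurable_cong_sets[OF sets_eq refl])

lemma norm_row_form_bound:
  "A \<in> space \<mu> \<Longrightarrow> k < n \<Longrightarrow> m \<le> n \<Longrightarrow> norm (row_form m a k A) \<le> sqrt (\<Sum>j<m. (norm (a j))\<^sup>2)"
  using norm_row_form_le[of A n m k a] by (simp add: space_eq real_le_rsqrt)

lemma integrable_row_form:
  assumes "k < n" "m \<le> n"
  shows "integrable \<mu> (\<lambda>A. (norm (row_form m a k A))\<^sup>2)"
  by (rule integrable_const_bound[where B="\<Sum>j<m. (norm (a j))\<^sup>2"])
     (use assms norm_row_form_le row_form_borel[OF assms] in \<open>auto simp: space_eq\<close>)

text \<open>All rows have equal second moments by invariance, and their sum over the
  \<open>n\<close> rows is deterministic.\<close>

lemma expectation_norm_row_form: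
  assumes k: "k < n" and m: "m \<le> n"
  shows "expectation (\<lambda>A. (norm (row_form m a k A))\<^sup>2) = (\<Sum>j<m. (norm (a j))\<^sup>2) / n"
proof -
  let ?h = "\<lambda>i A. (norm (row_form m a i A))\<^sup>2"
  have eq: "expectation (?h i) = expectation (?h k)" if i: "i < n" "i \<noteq> k" for i
  proof -
    \<comment> \<open>A quarter turn with phase 1 moves row \<open>k\<close> into row
      \<open>i\<close> without a sign.\<close>
    let ?V = "plane_rotation n i k 1 (pi / 2)"
    have "expectation (?h i) = expectation (\<lambda>A. ?h i (?V * A))"
      using row_form_borel[OF i(1) m]
      by (intro haar_integral_mult[of n, symmetric] haar plane_rotation_unitary i k) auto
    also have "\<dots> = expectation (?h k)"
      using i k m by (intro Bochner_Integration.integral_cong refl)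
        (auto simp: space_eq unitary_group_def row_form_plane_rotation)
    finally show ?thesis .
  qed
  have "real n * expectation (?h k) = (\<Sum>i<n. expectation (?h i))"
    using eq by (subst sum.cong[OF refl, of _ _ "\<lambda>_. expectation (?h k)"]) auto
  also have "\<dots> = expectation (\<lambda>A. \<Sum>i<n. ?h i A)"
    using integrable_row_form m by (intro Bochner_Integration.integral_sum[symmetric]) auto
  also have "\<dots> = expectation (\<lambda>A. \<Sum>j<m. (norm (a j))\<^sup>2)"
    using m by (intro Bochner_Integration.integral_cong refl) (auto simp: space_eq sum_norm_row_form)
  also have "\<dots> = (\<Sum>j<m. (norm (a j))\<^sup>2)" by (simp add: prob_space)
  finally show ?thesis using k by (simp add: field_simps)
qed

end

text \<open>The general real linear form on the upper left block, written with a separate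
  coefficient vector for each row so that a rotation of row \<open>i\<close> affects a single
  summand.\<close>

definition truncation_form :: "nat \<Rightarrow> (nat \<Rightarrow> nat \<Rightarrow> complex) \<Rightarrow> complex mat \<Rightarrow> real" where
  "truncation_form m a A = (\<Sum>r<m. Re (row_form m (a r) r A))"

context haar_unitary begin

lemma truncation_form_borel: "m \<le> n \<Longrightarrow> truncation_form m a \<in> borel_measurable \<mu>"
  unfolding truncation_form_def[abs_def]
  by (intro borel_measurable_sum measurable_compose[OF row_form_borel borel_measurable_Re]) auto

lemma cis_truncation_form_borel:
  "m \<le> n \<Longrightarrow> (\<lambda>A. cis (\<tau> * truncation_form m a A)) \<in> borel_measurable \<mu>"
  using truncation_form_borel[of m a] unfolding cis_conv_exp by measurable

lemma integrable_row_form_cis: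
  assumes "k < n" "m \<le> n"
  shows "integrable \<mu> (\<lambda>A. of_real ((norm (row_form m b k A))\<^sup>2) * cis (\<tau> * truncation_form m a A))"
proof (rule Bochner_Integration.integrable_bound[OF integrable_row_form[OF assms, of b]])
  show "(\<lambda>A. of_real ((norm (row_form m b k A))\<^sup>2) * cis (\<tau> * truncation_form m a A)) \<in> borel_measurable \<mu>"
    using row_form_borel[OF assms, of b] cis_truncation_form_borel[OF assms(2), of \<tau> a]
    by (intro borel_measurable_times) auto
qed (auto simp: norm_mult norm_power)

lemma integrable_Re_row_form_cis:
  assumes "k < n" "m \<le> n"
  shows "integrable \<mu> (\<lambda>A. of_real (Re (row_form m b k A)) * cis (\<tau> * truncation_form m a A))"
proof (rule integrable_const_bound[where B="sqrt (\<Sum>j<m. (norm (b j))\<^sup>2)"])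
  show "(\<lambda>A. of_real (Re (row_form m b k A)) * cis (\<tau> * truncation_form m a A)) \<in> borel_measurable \<mu>"
    using row_form_borel[OF assms, of b] cis_truncation_form_borel[OF assms(2), of \<tau> a]
    by (intro borel_measurable_times) auto
qed (use order_trans[OF abs_Re_le_cmod norm_row_form_bound[OF _ assms, of _ b]]
     in \<open>auto simp: norm_mult intro!: AE_I2\<close>)

text \<open>Since k \<ge> m, the rotation of rows \<open>i\<close> and \<open>k\<close> changes only
  the summand of row \<open>i\<close> in the truncation form. This is the setting of
  \<open>rotation_integration_by_parts\<close>, with \<open>b\<close> the sum over the other rows of
  the block.\<close>

lemma rotation_identity:
  assumes w: "norm w = 1" and i: "i < m" and k: "m \<le> k" "k < n"
  shows "(\<integral>A. of_real (Re (row_form m (a i) i A)) * cis (\<tau> * truncation_form m a A) \<partial>\<mu>) =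
    \<i> * of_real \<tau> * (\<integral>A. of_real ((Re (w * row_form m (a i) k A))\<^sup>2) * cis (\<tau> * truncation_form m a A) \<partial>\<mu>)"
proof -
  have m: "m \<le> n" "i < n" "i \<noteq> k" using i k by auto
  define x where "x A = Re (row_form m (a i) i A)" for A
  define y where "y A = Re (w * row_form m (a i) k A)" for A
  define b where "b A = (\<Sum>r\<in>{..<m} - {i}. Re (row_form m (a r) r A))" for A
  define C where "C = sqrt (\<Sum>j<m. (norm (a i j))\<^sup>2)"
  have bx: "truncation_form m a A = b A + x A" for A
    using i by (simp add: truncation_form_def b_def x_def sum.remove[of "{..<m}" i] add.commute)
  have x: "x \<in> borel_measurable \<mu>"
    unfolding x_def[abs_def] by (intro measurable_compose[OF row_form_borel borel_measurable_Re] m)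
  have y: "y \<in> borel_measurable \<mu>"
    unfolding y_def[abs_def] using row_form_borel[OF k(2) m(1), of "a i"] by measurable
  have b: "b \<in> borel_measurable \<mu>"
    unfolding b_def[abs_def] using m
    by (intro borel_measurable_sum measurable_compose[OF row_form_borel borel_measurable_Re]) auto
  have xC: "\<bar>x A\<bar> \<le> C" if "A \<in> space \<mu>" for A
    using norm_row_form_bound[OF that m(2,1), of "a i"] abs_Re_le_cmod order_trans
    unfolding x_def C_def by blast
  have yC: "\<bar>y A\<bar> \<le> C" if "A \<in> space \<mu>" for A
  proof -
    have "\<bar>y A\<bar> \<le> norm (w * row_form m (a i) k A)" unfolding y_def by (rule abs_Re_le_cmod)
    also have "\<dots> = norm (row_form m (a i) k A)" using w by (simp add: norm_mult)
    also have "\<dots> \<le> C" unfolding C_def by (rule norm_row_form_bound[OF that k(2) m(1)])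
    finally show ?thesis .
  qed
  \<comment> \<open>Invariance is applied to this function. Composing it with the rotation gives the
    integrand that depends on the angle, and its own integral is the constant.\<close>
  let ?h = "\<lambda>A. of_real (y A) * cis (\<tau> * truncation_form m a A)"
  have "(\<integral>A. of_real (cos \<theta> * y A - sin \<theta> * x A) * cis (\<tau> * (b A + cos \<theta> * x A + sin \<theta> * y A)) \<partial>\<mu>)
      = (\<integral>A. ?h A \<partial>\<mu>)" for \<theta>
  proof -
    let ?V = "plane_rotation n i k w \<theta>"
    have "(\<integral>A. of_real (cos \<theta> * y A - sin \<theta> * x A) * cis (\<tau> * (b A + cos \<theta> * x A + sin \<theta> * y A)) \<partial>\<mu>)
      = (\<integral>A. ?h (?V * A) \<partial>\<mu>)"
    proof (intro Bochner_Integration.integral_cong refl)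
      fix A assume "A \<in> space \<mu>"
      then have A: "A \<in> carrier_mat n n" by (simp add: space_eq unitary_group_def)
      \<comment> \<open>The factor \<open>w\<close> in \<open>y\<close> cancels the conjugate phase
        in row \<open>k\<close> of the rotation, so (x, y) undergoes a plain real rotation.\<close>
      have ww: "w * (cnj w * z) = z" for z
        using w complex_norm_square[of w] by (simp add: mult.assoc[symmetric])
      have Re_of_real_mult: "Re (of_real c * z) = c * Re z" for c z by simp
      have "w * row_form m (a i) k (?V * A) =
          of_real (cos \<theta>) * (w * row_form m (a i) k A) - of_real (sin \<theta>) * (w * (cnj w * row_form m (a i) i A))"
        using A m k by (simp add: row_form_plane_rotation algebra_simps)
      then have "y (?V * A) = cos \<theta> * y A - sin \<theta> * x A"
        unfolding ww y_def x_def by (simp only: minus_complex.sel Re_of_real_mult)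
      moreover have "x (?V * A) = cos \<theta> * x A + sin \<theta> * y A"
        using A m k by (simp add: x_def y_def row_form_plane_rotation)
      moreover have "b (?V * A) = b A"
        unfolding b_def using A m k by (intro sum.cong refl) (auto simp: row_form_plane_rotation)
      ultimately show "of_real (cos \<theta> * y A - sin \<theta> * x A) * cis (\<tau> * (b A + cos \<theta> * x A + sin \<theta> * y A))
          = ?h (?V * A)"
        by (simp add: bx add.assoc)
    qed
    also have "\<dots> = (\<integral>A. ?h A \<partial>\<mu>)"
    proof (rule haar_integral_mult[OF haar])
      show "?V \<in> unitary_group n" by (rule plane_rotation_unitary[OF m(2) k(2) m(3) w])
      show "?h \<in> borel_measurable \<mu>"
        using y cis_truncation_form_borel[OF m(1)] by (intro borel_measurable_times) auto
    qed
    finally show ?thesis .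
  qed
  from rotation_integration_by_parts[OF x y b xC yC this]
  show ?thesis by (simp add: bx x_def y_def)
qed

text \<open>The left side of \<open>rotation_identity\<close> is the same for every phase. Adding
  the cases 1 and \<open>\<i>\<close> doubles it, and the squares of Re z and Re
  (\<open>\<i>\<close> z) add up to the squared modulus.\<close>

lemma rotation_identity_norm:
  assumes i: "i < m" and k: "m \<le> k" "k < n"
  shows "2 * (\<integral>A. of_real (Re (row_form m (a i) i A)) * cis (\<tau> * truncation_form m a A) \<partial>\<mu>) =
    \<i> * of_real \<tau> * (\<integral>A. of_real ((norm (row_form m (a i) k A))\<^sup>2) * cis (\<tau> * truncation_form m a A) \<partial>\<mu>)"
proof -
  have m: "m \<le> n" using k by simp
  let ?c = "\<lambda>A. cis (\<tau> * truncation_form m a A)"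
  let ?g = "\<lambda>w A. of_real ((Re (w * row_form m (a i) k A))\<^sup>2) * ?c A"
  have int: "integrable \<mu> (?g w)" if "norm w = 1" for w
  proof (rule Bochner_Integration.integrable_bound[OF integrable_row_form[OF k(2) m, of "a i"]])
    have "(\<lambda>A. (Re (w * row_form m (a i) k A))\<^sup>2) \<in> borel_measurable \<mu>"
      using row_form_borel[OF k(2) m, of "a i"] by measurable
    then show "?g w \<in> borel_measurable \<mu>"
      using cis_truncation_form_borel[OF m, of \<tau> a]
      by (intro borel_measurable_times measurable_compose[OF _ borel_measurable_of_real]) auto
    have "(Re (w * z))\<^sup>2 \<le> (norm z)\<^sup>2" for z
      using power_mono[OF abs_Re_le_cmod[of "w * z"] abs_ge_zero, of 2] that
      by (simp add: norm_mult del: times_complex.sel)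
    then show "AE A in \<mu>. norm (?g w A) \<le> norm ((norm (row_form m (a i) k A))\<^sup>2)"
      by (simp add: norm_mult norm_power del: times_complex.sel)
  qed
  have "?g 1 A + ?g \<i> A = of_real ((norm (row_form m (a i) k A))\<^sup>2) * ?c A" for A
    unfolding cmod_power2 by (simp add: algebra_simps)
  then have sum: "(\<integral>A. of_real ((norm (row_form m (a i) k A))\<^sup>2) * ?c A \<partial>\<mu>)
      = (\<integral>A. ?g 1 A \<partial>\<mu>) + (\<integral>A. ?g \<i> A \<partial>\<mu>)"
    using Bochner_Integration.integral_add[OF int[OF norm_one] int[OF norm_ii]] by presburger
  have "2 * (\<integral>A. of_real (Re (row_form m (a i) i A)) * ?c A \<partial>\<mu>) =
      \<i> * of_real \<tau> * (\<integral>A. ?g 1 A \<partial>\<mu>) + \<i> * of_real \<tau> * (\<integral>A. ?g \<i> A \<partial>\<mu>)"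
    unfolding rotation_identity[OF norm_one i k, of a \<tau>, symmetric] rotation_identity[OF norm_ii i k, of a \<tau>, symmetric]
    by (rule mult_2)
  then show ?thesis unfolding sum distrib_left .
qed

text \<open>The rows k < m occur in the form itself and have no rotation identity, so they are split
  off as \<open>D\<close>. In \<open>D\<close> the oscillating factor has modulus one, and each row
  contributes at most its second moment.\<close>

lemma rotation_identity_sum:
  fixes a :: "nat \<Rightarrow> nat \<Rightarrow> complex" and \<tau> :: real
  assumes i: "i < m" and m: "m < n"
  defines "\<phi> \<equiv> \<integral>A. cis (\<tau> * truncation_form m a A) \<partial>\<mu>"
  defines "D \<equiv> \<Sum>k<m. \<integral>A. of_real ((norm (row_form m (a i) k A))\<^sup>2) * cis (\<tau> * truncation_form m a A) \<partial>\<mu>"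
  shows "2 * of_nat (n - m) * (\<integral>A. of_real (Re (row_form m (a i) i A)) * cis (\<tau> * truncation_form m a A) \<partial>\<mu>) =
    \<i> * of_real \<tau> * (of_real (\<Sum>j<m. (norm (a i j))\<^sup>2) * \<phi> - D)"
    and "norm D \<le> real m * ((\<Sum>j<m. (norm (a i j))\<^sup>2) / n)"
proof -
  let ?c = "\<lambda>A. cis (\<tau> * truncation_form m a A)"
  let ?I = "\<lambda>k. \<integral>A. of_real ((norm (row_form m (a i) k A))\<^sup>2) * ?c A \<partial>\<mu>"
  let ?L = "\<integral>A. of_real (Re (row_form m (a i) i A)) * ?c A \<partial>\<mu>"
  have "2 * of_nat (n - m) * ?L = (\<Sum>k=m..<n. 2 * ?L)" by simp
  also have "\<dots> = (\<Sum>k=m..<n. \<i> * of_real \<tau> * ?I k)"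
    using i by (intro sum.cong refl rotation_identity_norm) auto
  also have "\<dots> = \<i> * of_real \<tau> * (\<Sum>k=m..<n. ?I k)" by (simp add: sum_distrib_left)
  \<comment> \<open>The sum is completed to all rows because only the full sum of squared moduli is
    constant on the unitary group.\<close>
  also have "(\<Sum>k=m..<n. ?I k) = (\<Sum>k<n. ?I k) - D"
    using m sum.atLeastLessThan_concat[of 0 m n ?I] by (simp add: D_def lessThan_atLeast0 algebra_simps)
  also have "(\<Sum>k<n. ?I k) = (\<integral>A. (\<Sum>k<n. of_real ((norm (row_form m (a i) k A))\<^sup>2) * ?c A) \<partial>\<mu>)"
    using m by (intro Bochner_Integration.integral_sum[symmetric] integrable_row_form_cis) auto
  also have "\<dots> = (\<integral>A. of_real (\<Sum>j<m. (norm (a i j))\<^sup>2) * ?c A \<partial>\<mu>)"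
  proof (intro Bochner_Integration.integral_cong refl)
    fix A assume "A \<in> space \<mu>"
    then have "(\<Sum>k<n. (norm (row_form m (a i) k A))\<^sup>2) = (\<Sum>j<m. (norm (a i j))\<^sup>2)"
      using m by (intro sum_norm_row_form) (auto simp: space_eq)
    then show "(\<Sum>k<n. of_real ((norm (row_form m (a i) k A))\<^sup>2) * ?c A) = of_real (\<Sum>j<m. (norm (a i j))\<^sup>2) * ?c A"
      by (simp only: sum_distrib_right[symmetric] of_real_sum[symmetric])
  qed
  also have "\<dots> = of_real (\<Sum>j<m. (norm (a i j))\<^sup>2) * \<phi>" unfolding \<phi>_def by (rule integral_mult_right_zero)
  finally show "2 * of_nat (n - m) * ?L = \<i> * of_real \<tau> * (of_real (\<Sum>j<m. (norm (a i j))\<^sup>2) * \<phi> - D)" .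
  have "norm (?I k) \<le> (\<Sum>j<m. (norm (a i j))\<^sup>2) / n" if "k < m" for k
  proof -
    have "norm (?I k) \<le> (\<integral>A. norm (of_real ((norm (row_form m (a i) k A))\<^sup>2) * ?c A) \<partial>\<mu>)"
      by (rule integral_norm_bound)
    also have "\<dots> = (\<integral>A. (norm (row_form m (a i) k A))\<^sup>2 \<partial>\<mu>)"
      by (simp add: norm_mult norm_power)
    also have "\<dots> = (\<Sum>j<m. (norm (a i j))\<^sup>2) / n"
      using that m by (intro expectation_norm_row_form) auto
    finally show ?thesis .
  qed
  then show "norm D \<le> real m * ((\<Sum>j<m. (norm (a i j))\<^sup>2) / n)"
    unfolding D_def using sum_norm_le[of "{..<m}" ?I "\<lambda>_. (\<Sum>j<m. (norm (a i j))\<^sup>2) / n"] by simp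
qed

lemma truncation_form_bound:
  assumes "m \<le> n"
  obtains C where "\<And>A. A \<in> space \<mu> \<Longrightarrow> \<bar>truncation_form m a A\<bar> \<le> C"
proof
  fix A assume A: "A \<in> space \<mu>"
  have "\<bar>truncation_form m a A\<bar> \<le> (\<Sum>r<m. \<bar>Re (row_form m (a r) r A)\<bar>)"
    unfolding truncation_form_def by (rule sum_abs)
  also have "\<dots> \<le> (\<Sum>r<m. sqrt (\<Sum>j<m. (norm (a r j))\<^sup>2))"
    using assms by (intro sum_mono order_trans[OF abs_Re_le_cmod] norm_row_form_bound A) auto
  finally show "\<bar>truncation_form m a A\<bar> \<le> (\<Sum>r<m. sqrt (\<Sum>j<m. (norm (a r j))\<^sup>2))" .
qed

text \<open>Summing the row identities over i < m gives the Gaussian equation with \<beta> = S / (4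
  (n - m)). The scale sqrt n of the truncation appears as the time at which the solution is read
  off; the factor 1 / sqrt m is left to the coefficients.\<close>

lemma truncation_char_bound:
  fixes a :: "nat \<Rightarrow> nat \<Rightarrow> complex"
  assumes m: "m < n"
  defines "S \<equiv> \<Sum>i<m. \<Sum>j<m. (norm (a i j))\<^sup>2"
  shows "norm ((\<integral>A. cis (sqrt n * truncation_form m a A) \<partial>\<mu>) - of_real (exp (- (S / (4 * real (n - m))) * n)))
    \<le> real m * S / (2 * real (n - m))"
proof -
  define W where "W = truncation_form m a"
  obtain C where C: "\<And>A. A \<in> space \<mu> \<Longrightarrow> \<bar>W A\<bar> \<le> C"
    using truncation_form_bound[of m a] m unfolding W_def by auto
  define \<phi> where "\<phi> \<tau> = (\<integral>A. cis (\<tau> * W A) \<partial>\<mu>)" for \<tau>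
  define \<phi>' where "\<phi>' \<tau> = (\<integral>A. \<i> * of_real (W A) * cis (\<tau> * W A) \<partial>\<mu>)" for \<tau>
  have W: "W \<in> borel_measurable \<mu>" and cW: "\<And>\<tau>. (\<lambda>A. cis (\<tau> * W A)) \<in> borel_measurable \<mu>"
    unfolding W_def using m truncation_form_borel cis_truncation_form_borel by auto
  have deriv: "(\<phi> has_vector_derivative \<phi>' \<tau>) (at \<tau>)" for \<tau>
    unfolding \<phi>_def[abs_def] \<phi>'_def
  proof (rule has_vector_derivative_integral[where B=C])
    show "integrable \<mu> (\<lambda>A. cis (t * W A))" for t
      by (rule integrable_const_bound[where B=1]) (use cW in auto)
    show "(\<lambda>A. \<i> * of_real (W A) * cis (\<tau> * W A)) \<in> borel_measurable \<mu>"
      using W cW by (intro borel_measurable_times) auto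
    show "((\<lambda>t. cis (t * W A)) has_vector_derivative \<i> * of_real (W A) * cis (t * W A)) (at t)" for t A
      unfolding has_vector_derivative_def
      by (auto intro!: derivative_eq_intros simp: scaleR_conv_of_real algebra_simps)
    show "norm (\<i> * of_real (W A) * cis (t * W A)) \<le> C" if "A \<in> space \<mu>" for t A
      using C[OF that] by (simp add: norm_mult)
  qed
  define d where "d = real (n - m)"
  have d: "d > 0" using m by (simp add: d_def)
  define s where "s i = (\<Sum>j<m. (norm (a i j))\<^sup>2)" for i
  define L where "L \<tau> i = (\<integral>A. of_real (Re (row_form m (a i) i A)) * cis (\<tau> * W A) \<partial>\<mu>)" for \<tau> i
  define D where "D \<tau> i = (\<Sum>k<m. \<integral>A. of_real ((norm (row_form m (a i) k A))\<^sup>2) * cis (\<tau> * W A) \<partial>\<mu>)" for \<tau> i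
  have L: "2 * of_real d * L \<tau> i = \<i> * of_real \<tau> * (of_real (s i) * \<phi> \<tau> - D \<tau> i)"
    and D: "norm (D \<tau> i) \<le> real m * (s i / n)" if "i < m" for \<tau> i
    using rotation_identity_sum[OF that m, where a=a and \<tau>=\<tau>]
    by (simp_all add: L_def D_def \<phi>_def W_def s_def d_def)
  have \<phi>'L: "\<phi>' \<tau> = \<i> * (\<Sum>i<m. L \<tau> i)" for \<tau>
  proof -
    have "(\<Sum>i<m. L \<tau> i) = (\<integral>A. (\<Sum>i<m. of_real (Re (row_form m (a i) i A)) * cis (\<tau> * W A)) \<partial>\<mu>)"
      unfolding L_def W_def using m
      by (intro Bochner_Integration.integral_sum[symmetric] integrable_Re_row_form_cis) auto
    also have "\<dots> = (\<integral>A. of_real (W A) * cis (\<tau> * W A) \<partial>\<mu>)"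
      by (simp only: sum_distrib_right[symmetric] of_real_sum[symmetric]) (simp add: W_def truncation_form_def)
    finally show ?thesis by (simp add: \<phi>'_def mult.assoc)
  qed
  \<comment> \<open>With d = n - m, the derivative equals -S \<tau> / (2 d) times the function plus
    \<tau> / (2 d) times the sum of the \<open>D\<close> terms, and that sum is at most m S / n in
    modulus.\<close>
  have ode: "norm (\<phi>' \<tau> + of_real (2 * (S / (4 * d)) * \<tau>) * \<phi> \<tau>) \<le> real m * S / (2 * real n * d) * \<bar>\<tau>\<bar>" for \<tau>
  proof -
    have "2 * of_real d * \<phi>' \<tau> = \<i> * (\<Sum>i<m. 2 * of_real d * L \<tau> i)"
      by (simp add: \<phi>'L sum_distrib_left mult_ac)
    also have "\<dots> = \<i> * (\<Sum>i<m. \<i> * of_real \<tau> * (of_real (s i) * \<phi> \<tau> - D \<tau> i))"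
      using L by simp
    also have "\<dots> = \<i> * (\<i> * of_real \<tau>) * ((\<Sum>i<m. of_real (s i)) * \<phi> \<tau> - (\<Sum>i<m. D \<tau> i))"
      by (simp only: sum_distrib_left[symmetric] sum_subtractf sum_distrib_right mult.assoc)
    also have "\<dots> = of_real \<tau> * (\<Sum>i<m. D \<tau> i) - of_real (S * \<tau>) * \<phi> \<tau>"
      by (simp add: S_def s_def algebra_simps)
    finally have eq: "2 * of_real d * (\<phi>' \<tau> + of_real (2 * (S / (4 * d)) * \<tau>) * \<phi> \<tau>) = of_real \<tau> * (\<Sum>i<m. D \<tau> i)"
      using d by (simp add: distrib_left)
    have "2 * d * norm (\<phi>' \<tau> + of_real (2 * (S / (4 * d)) * \<tau>) * \<phi> \<tau>) = \<bar>\<tau>\<bar> * norm (\<Sum>i<m. D \<tau> i)"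
      using arg_cong[OF eq, of norm] d unfolding norm_mult norm_of_real by simp
    also have "norm (\<Sum>i<m. D \<tau> i) \<le> (\<Sum>i<m. real m * (s i / n))"
      using D by (intro sum_norm_le) auto
    also have "\<dots> = real m * S / n"
      by (simp add: S_def s_def sum_distrib_left sum_divide_distrib)
    finally have "2 * d * norm (\<phi>' \<tau> + of_real (2 * (S / (4 * d)) * \<tau>) * \<phi> \<tau>) \<le> \<bar>\<tau>\<bar> * (real m * S / n)"
      by (simp add: mult_left_mono)
    then have "norm (\<phi>' \<tau> + of_real (2 * (S / (4 * d)) * \<tau>) * \<phi> \<tau>) \<le> \<bar>\<tau>\<bar> * (real m * S / n) / (2 * d)"
      using d by (simp only: pos_le_divide_eq mult.commute zero_less_mult_iff zero_less_numeral simp_thms)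
    also have "\<dots> = real m * S / (2 * real n * d) * \<bar>\<tau>\<bar>" by (simp add: mult_ac)
    finally show ?thesis .
  qed
  have "norm (\<phi> (sqrt n) - of_real (exp (- (S / (4 * d)) * (sqrt n)\<^sup>2))) \<le> real m * S / (2 * real n * d) * (sqrt n)\<^sup>2"
  proof (rule gaussian_ode_bound[OF deriv])
    show "\<phi> 0 = 1" by (simp add: \<phi>_def prob_space)
    show "S / (4 * d) \<ge> 0" using d by (auto simp: S_def intro!: divide_nonneg_nonneg sum_nonneg)
    show "norm (\<phi>' t + of_real (2 * (S / (4 * d)) * t) * \<phi> t) \<le> real m * S / (2 * real n * d) * \<bar>t\<bar>" for t
      by (rule ode)
  qed simp
  also have "real m * S / (2 * real n * d) * (sqrt n)\<^sup>2 = real m * S / (2 * d)" using m by simp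
  finally show ?thesis by (simp add: \<phi>_def W_def d_def)
qed

end

section \<open>The Gaussian limit\<close>

lemma expectation_cis_normal:
  assumes "\<sigma> > 0"
  shows "(\<integral>x. cis (t * x) \<partial>density lborel (normal_density 0 \<sigma>)) = of_real (exp (- (\<sigma> * t)\<^sup>2 / 2))"
proof -
  interpret std: prob_space std_normal_distribution
    by (rule prob_space_normal_density) simp
  have "distributed std_normal_distribution lborel (\<lambda>x. x) (normal_density 0 1)"
    by (auto simp: distributed_def distr_id2)
  then have "distributed std_normal_distribution lborel (\<lambda>x. 0 + \<sigma> * x) (normal_density (0 + \<sigma> * 0) (\<bar>\<sigma>\<bar> * 1))"
    by (rule std.normal_density_affine) (use assms in auto)
  then have "density lborel (normal_density 0 \<sigma>) = distr std_normal_distribution lborel (\<lambda>x. \<sigma> * x)"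
    using assms by (simp add: distributed_def)
  then have "(\<integral>x. cis (t * x) \<partial>density lborel (normal_density 0 \<sigma>)) = (\<integral>x. cis (t * (\<sigma> * x)) \<partial>std_normal_distribution)"
    by (simp add: integral_distr cis_conv_exp)
  also have "\<dots> = char std_normal_distribution (\<sigma> * t)"
    by (simp add: char_def cis_conv_exp mult_ac)
  finally show ?thesis by (simp add: char_std_normal_distribution)
qed

text \<open>Real and imaginary parts have variance 1/2, so each contributes a quarter of the squared
  component of \<open>a\<close> to the exponent.\<close>

lemma expectation_cis_standard_complex_normal:
  "(\<integral>\<xi>. cis (Re (cnj a * \<xi>)) \<partial>standard_complex_normal) = of_real (exp (- (norm a)\<^sup>2 / 4))"
proof -
  let ?P = "density lborel (normal_density 0 (sqrt (1/2)))"
  interpret P: prob_space ?P by (rule prob_space_normal_density) simp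
  interpret PP: pair_prob_space ?P ?P ..
  have m: "(\<lambda>(x, y). Complex x y) \<in> borel_measurable (?P \<Otimes>\<^sub>M ?P)"
    unfolding Complex_eq by measurable
  have "(\<integral>\<xi>. cis (Re (cnj a * \<xi>)) \<partial>standard_complex_normal)
      = (\<integral>z. cis (Re (cnj a * (case z of (x, y) \<Rightarrow> Complex x y))) \<partial>(?P \<Otimes>\<^sub>M ?P))"
    unfolding standard_complex_normal_def by (subst integral_distr[OF m]) (auto simp: cis_conv_exp)
  also have "\<dots> = (\<integral>(x, y). cis (Re a * x) * cis (Im a * y) \<partial>(?P \<Otimes>\<^sub>M ?P))"
    by (intro Bochner_Integration.integral_cong) (auto simp: cis_mult)
  also have "\<dots> = (\<integral>x. \<integral>y. cis (Re a * x) * cis (Im a * y) \<partial>?P \<partial>?P)"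
  proof -
    have "integrable (?P \<Otimes>\<^sub>M ?P) (\<lambda>(x, y). cis (Re a * x) * cis (Im a * y))"
      by (rule PP.integrable_const_bound[where B=1]) (auto simp: norm_mult cis_conv_exp)
    from PP.integral_fst'[OF this] show ?thesis by simp
  qed
  also have "\<dots> = (\<integral>x. cis (Re a * x) \<partial>?P) * (\<integral>y. cis (Im a * y) \<partial>?P)"
    by simp
  also have "\<dots> = of_real (exp (- (norm a)\<^sup>2 / 4))"
  proof -
    have "- (sqrt (1/2) * Re a)\<^sup>2 / 2 + - (sqrt (1/2) * Im a)\<^sup>2 / 2 = - (norm a)\<^sup>2 / 4"
      by (simp add: power_mult_distrib cmod_power2 field_simps)
    then show ?thesis
      by (simp only: expectation_cis_normal real_sqrt_gt_0_iff zero_less_divide_1_iff zero_less_numeral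
          of_real_mult[symmetric] exp_add[symmetric])
  qed
  finally show ?thesis .
qed

lemma standard_gaussian_matrix_char:
  assumes G: "standard_gaussian_matrix m N G"
  shows "(\<integral>\<omega>. cis (\<Sum>p\<in>{..<m} \<times> {..<m}. Re (cnj (a p) * G \<omega> $$ p)) \<partial>N)
    = of_real (exp (- (\<Sum>p\<in>{..<m} \<times> {..<m}. (norm (a p))\<^sup>2) / (4 * m)))"
proof -
  let ?I = "{..<m} \<times> {..<m}"
  interpret prob_space N using G by (simp add: standard_gaussian_matrix_def)
  have indep: "indep_vars (\<lambda>_. borel) (\<lambda>p \<omega>. G \<omega> $$ p) ?I"
    and distr: "\<And>p. p \<in> ?I \<Longrightarrow> distr N borel (\<lambda>\<omega>. G \<omega> $$ p) =
        distr standard_complex_normal borel (\<lambda>\<xi>. \<xi> / complex_of_real (sqrt (real m)))"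
    using G by (auto simp: standard_gaussian_matrix_def)
  have meas: "(\<lambda>\<omega>. G \<omega> $$ p) \<in> borel_measurable N" if "p \<in> ?I" for p
    using indep that by (auto simp: indep_vars_def)
  define X where "X p \<omega> = Re (cnj (a p) * G \<omega> $$ p)" for p \<omega>
  have X: "indep_vars (\<lambda>_. borel) X ?I"
    unfolding X_def[abs_def]
    by (rule indep_vars_compose2[OF indep, of "\<lambda>p z. Re (cnj (a p) * z)"]) measurable
  have measX: "X p \<in> borel_measurable N" if "p \<in> ?I" for p
    using X that by (auto simp: indep_vars_def)
  \<comment> \<open>The frequency already sits in the coefficients \<open>a\<close>, so
    characteristic functions are evaluated at 1. The scaling by 1 / sqrt m is real and moves from
    the variable to the coefficient.\<close>
  have charX: "char (distr N borel (X p)) 1 = of_real (exp (- (norm (a p))\<^sup>2 / (4 * m)))" if p: "p \<in> ?I" for p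
  proof -
    have "m > 0" using p by auto
    have "char (distr N borel (X p)) 1 = (\<integral>\<omega>. cis (Re (cnj (a p) * G \<omega> $$ p)) \<partial>N)"
      using measX[OF p] by (simp add: char_def integral_distr cis_conv_exp X_def)
    also have "\<dots> = (\<integral>z. cis (Re (cnj (a p) * z)) \<partial>distr N borel (\<lambda>\<omega>. G \<omega> $$ p))"
      using meas[OF p] by (subst integral_distr) (auto simp: cis_conv_exp)
    also have "\<dots> = (\<integral>\<xi>. cis (Re (cnj (a p) * (\<xi> / complex_of_real (sqrt (real m))))) \<partial>standard_complex_normal)"
      unfolding distr[OF p]
      by (subst integral_distr) (auto simp: cis_conv_exp standard_complex_normal_def)
    also have "\<dots> = (\<integral>\<xi>. cis (Re (cnj (a p / complex_of_real (sqrt (real m))) * \<xi>)) \<partial>standard_complex_normal)"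
      by simp
    also have "\<dots> = of_real (exp (- (norm (a p))\<^sup>2 / (4 * m)))"
      unfolding expectation_cis_standard_complex_normal
      by (simp add: norm_divide power_divide mult.commute)
    finally show ?thesis .
  qed
  have "(\<integral>\<omega>. cis (\<Sum>p\<in>?I. Re (cnj (a p) * G \<omega> $$ p)) \<partial>N) = char (distr N borel (\<lambda>\<omega>. \<Sum>p\<in>?I. X p \<omega>)) 1"
  proof -
    have "(\<lambda>\<omega>. \<Sum>p\<in>?I. X p \<omega>) \<in> borel_measurable N" using measX by (intro borel_measurable_sum) auto
    then show ?thesis by (simp add: char_def integral_distr cis_conv_exp X_def)
  qed
  also have "\<dots> = (\<Prod>p\<in>?I. char (distr N borel (X p)) 1)"
    by (rule char_distr_sum[OF X])
  also have "\<dots> = (\<Prod>p\<in>?I. of_real (exp (- (norm (a p))\<^sup>2 / (4 * m))))"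
    by (intro prod.cong refl charX)
  also have "\<dots> = of_real (exp (\<Sum>p\<in>?I. - (norm (a p))\<^sup>2 / (4 * m)))"
    by (simp add: exp_sum)
  also have "(\<Sum>p\<in>?I. - (norm (a p))\<^sup>2 / (4 * m)) = - (\<Sum>p\<in>?I. (norm (a p))\<^sup>2) / (4 * m)"
    by (simp add: sum_divide_distrib sum_negf)
  finally show ?thesis .
qed

section \<open>Uniform tightness of the scaled truncations\<close>

text \<open>Markov's inequality for the sum \<open>Q\<close> of the squared scaled entries. Each of
  the m^2 entries contributes (n / m) (1 / n), so the expectation is \<open>m\<close>, whatever
  \<open>n\<close> is.\<close>

lemma (in haar_unitary) truncation_tail:
  assumes m: "0 < m" "m \<le> n" and R: "R > 0"
  shows "prob {A \<in> space \<mu>. \<exists>p\<in>{..<m} \<times> {..<m}. norm (complex_of_real (sqrt (n / m)) * A $$ p) > R} \<le> m / R\<^sup>2"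
proof -
  let ?I = "{..<m} \<times> {..<m}"
  \<comment> \<open>A unit coefficient vector makes an entry a special row form, whose second moment
    is known.\<close>
  have entry: "A $$ p = row_form m (\<lambda>l. if l = snd p then 1 else 0) (fst p) A" if "p \<in> ?I" for A p
    using that by (auto simp: row_form_def if_distrib[of cnj] if_distrib[of "\<lambda>x. x * _"] cong: if_cong)
  have int: "integrable \<mu> (\<lambda>A. (norm (A $$ p))\<^sup>2)" and ex: "expectation (\<lambda>A. (norm (A $$ p))\<^sup>2) = 1 / n"
    if p: "p \<in> ?I" for p
  proof -
    have "(\<Sum>l<m. (norm (if l = snd p then 1 else (0::complex)))\<^sup>2) = 1"
      using p by (simp add: if_distrib[of "\<lambda>x. (norm x)\<^sup>2"] cong: if_cong) auto
    then show "integrable \<mu> (\<lambda>A. (norm (A $$ p))\<^sup>2)" "expectation (\<lambda>A. (norm (A $$ p))\<^sup>2) = 1 / n"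
      unfolding entry[OF p] using p m
      by (auto intro!: integrable_row_form simp: expectation_norm_row_form)
  qed
  define Q where "Q A = (\<Sum>p\<in>?I. (n / m) * (norm (A $$ p))\<^sup>2)" for A :: "complex mat"
  have Q0: "0 \<le> Q A" for A unfolding Q_def by (intro sum_nonneg) simp
  have intQ: "integrable \<mu> Q"
    unfolding Q_def[abs_def] using int by (intro Bochner_Integration.integrable_sum integrable_mult_right) auto
  have "expectation Q = (\<Sum>p\<in>?I. (n / m) * expectation (\<lambda>A. (norm (A $$ p))\<^sup>2))"
    unfolding Q_def[abs_def] using int
    by (subst Bochner_Integration.integral_sum) (auto intro: integrable_mult_right)
  also have "\<dots> = m"
    using m ex by (simp add: card_cartesian_product)
  finally have EQ: "expectation Q = m" .
  have "prob {A \<in> space \<mu>. \<exists>p\<in>?I. norm (complex_of_real (sqrt (n / m)) * A $$ p) > R} \<le> prob {A \<in> space \<mu>. Q A \<ge> R\<^sup>2}"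
  proof (rule finite_measure_mono)
    show "{A \<in> space \<mu>. R\<^sup>2 \<le> Q A} \<in> events" using intQ by measurable
    show "{A \<in> space \<mu>. \<exists>p\<in>?I. norm (complex_of_real (sqrt (n / m)) * A $$ p) > R} \<subseteq> {A \<in> space \<mu>. R\<^sup>2 \<le> Q A}"
    proof
      fix A assume "A \<in> {A \<in> space \<mu>. \<exists>p\<in>?I. norm (complex_of_real (sqrt (n / m)) * A $$ p) > R}"
      then obtain p where A: "A \<in> space \<mu>" and p: "p \<in> ?I"
        and less: "R < norm (complex_of_real (sqrt (n / m)) * A $$ p)" by blast
      have "R\<^sup>2 \<le> (norm (complex_of_real (sqrt (n / m)) * A $$ p))\<^sup>2"
        using less R by (intro power_mono) auto
      also have "\<dots> = (n / m) * (norm (A $$ p))\<^sup>2"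
        by (simp add: norm_mult power_mult_distrib)
      also have "\<dots> \<le> Q A"
        unfolding Q_def using member_le_sum[OF p, of "\<lambda>p. (n / m) * (norm (A $$ p))\<^sup>2"] by simp
      finally show "A \<in> {A \<in> space \<mu>. R\<^sup>2 \<le> Q A}" using A by simp
    qed
  qed
  also have "\<dots> \<le> expectation Q / R\<^sup>2"
    by (rule integral_Markov_inequality_measure[where A="{}"])
       (use intQ R Q0 in auto)
  finally show ?thesis by (simp add: EQ)
qed

lemma haar_unitary_distr:
  assumes "haar_unitary_random_matrix n M U"
  shows "haar_unitary n (distr M (unitary_borel n) U)"
  using assms
  by (auto simp: haar_unitary_def haar_unitary_axioms_def haar_unitary_random_matrix_def normalized_haar_measure_def)

lemma continuous_map_scaled_truncation:
  assumes "m \<le> n"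
  shows "continuous_map (subtopology (mat_topology n) (unitary_group n)) (mat_topology m)
    (\<lambda>A. c \<cdot>\<^sub>m truncation m A)"
proof (rule continuous_map_mat_topologyI)
  fix i j assume ij: "i < m" "j < m"
  have "continuous_map (subtopology (mat_topology n) (unitary_group n)) euclidean (\<lambda>A. c * A $$ (i, j))"
    using ij assms
    by (intro continuous_map_compose_continuous_on_UNIV[where g="\<lambda>z. c * z"]
        continuous_map_from_subtopology continuous_map_mat_entry continuous_intros) auto
  then show "continuous_map (subtopology (mat_topology n) (unitary_group n)) euclidean
      (\<lambda>A. (c \<cdot>\<^sub>m truncation m A) $$ (i, j))"
    using ij by (simp add: truncation_def)
qed (auto simp: truncation_def)

theorem theorem6p1:
  fixes m :: nat
    and M :: "nat \<Rightarrow> 'a measure" and U :: "nat \<Rightarrow> 'a \<Rightarrow> complex mat"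
    and N :: "'b measure" and G :: "'b \<Rightarrow> complex mat"
  assumes "m \<ge> 1"
    and "\<And>n. n > m \<Longrightarrow> haar_unitary_random_matrix n (M n) (U n)"
    and "standard_gaussian_matrix m N G"
  shows "converges_in_distribution (mat_topology m)
           M (\<lambda>n \<omega>. complex_of_real (sqrt (real n / real m)) \<cdot>\<^sub>m truncation m (U n \<omega>))
           N G"
proof -
  let ?I = "{..<m} \<times> {..<m}"
  let ?T = "\<lambda>n \<omega>. complex_of_real (sqrt (real n / real m)) \<cdot>\<^sub>m truncation m (U n \<omega>)"
  \<comment> \<open>Matrices are traded for functions on all index pairs, set to zero outside the
    block as the continuity theorem demands.\<close>
  define X where "X n \<omega> p = (if p \<in> ?I then complex_of_real (sqrt (real n / real m)) * U n \<omega> $$ p else 0)" for n \<omega> p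
  define Y where "Y \<omega> p = (if p \<in> ?I then G \<omega> $$ p else 0)" for \<omega> p
  have m: "m > 0" using \<open>m \<ge> 1\<close> by simp
  have probM: "prob_space (M n)" and UM: "U n \<in> M n \<rightarrow>\<^sub>M unitary_borel n" if "n > m" for n
    using assms(2)[OF that] by (auto simp: haar_unitary_random_matrix_def)
  have N: "prob_space N" and GN: "G \<in> N \<rightarrow>\<^sub>M borel_on (mat_topology m)"
    using assms(3) by (auto simp: standard_gaussian_matrix_def)
  have TM: "?T n \<in> M n \<rightarrow>\<^sub>M borel_on (mat_topology m)" if "n > m" for n
    using measurable_compose[OF UM[OF that, unfolded unitary_borel_def]
        measurable_borel_on[OF continuous_map_scaled_truncation]] that by simp
  have Xmat: "?T n \<omega> = mat m m (X n \<omega>)" for n \<omega>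
    by (rule eq_matI) (auto simp: X_def truncation_def)
  \<comment> \<open>Restricted to the sample space: only there does measurability of
    \<open>G\<close> guarantee the dimensions.\<close>
  have Gmat: "G \<omega> = mat m m (Y \<omega>)" if "\<omega> \<in> space N" for \<omega>
    using measurable_space[OF GN that] by (intro eq_matI) (auto simp: Y_def)
  have Xmeas: "(\<lambda>\<omega>. X n \<omega> p) \<in> borel_measurable (M n)" if "n > m" "p \<in> ?I" for n p
    using measurable_compose[OF UM[OF that(1)] unitary_entry_measurable[of "fst p" n "snd p"]] that
    by (auto simp: X_def)
  have Ymeas: "(\<lambda>\<omega>. Y \<omega> p) \<in> borel_measurable N" if "p \<in> ?I" for p
    using measurable_compose[OF GN measurable_borel_on[OF continuous_map_mat_entry[of "fst p" m "snd p"]]] that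
    by (auto simp: Y_def borel_on_euclidean)

  have char: "(\<lambda>n. \<integral>\<omega>. cis (\<Sum>p\<in>?I. Re (cnj (a p) * X n \<omega> p)) \<partial>M n)
      \<longlonglongrightarrow> (\<integral>\<omega>. cis (\<Sum>p\<in>?I. Re (cnj (a p) * Y \<omega> p)) \<partial>N)" for a
  proof -
    \<comment> \<open>From sqrt (n / m) = sqrt n / sqrt m the second factor goes into the
      coefficients. The resulting exponent S / 4 matches that of the Gaussian matrix.\<close>
    define b where "b i j = a (i, j) / complex_of_real (sqrt m)" for i j
    define S where "S = (\<Sum>i<m. \<Sum>j<m. (norm (b i j))\<^sup>2)"
    have S: "S = (\<Sum>p\<in>?I. (norm (a p))\<^sup>2) / m"
      by (simp add: S_def b_def norm_divide power_divide sum_divide_distrib sum.cartesian_product case_prod_unfold)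
    have "(\<integral>\<omega>. cis (\<Sum>p\<in>?I. Re (cnj (a p) * Y \<omega> p)) \<partial>N)
        = (\<integral>\<omega>. cis (\<Sum>p\<in>?I. Re (cnj (a p) * G \<omega> $$ p)) \<partial>N)"
      by (intro Bochner_Integration.integral_cong refl arg_cong[where f=cis] sum.cong) (auto simp: Y_def)
    also have "\<dots> = of_real (exp (- (S / 4)))"
      unfolding standard_gaussian_matrix_char[OF assms(3)] by (simp add: S mult.commute)
    finally have limit: "(\<integral>\<omega>. cis (\<Sum>p\<in>?I. Re (cnj (a p) * Y \<omega> p)) \<partial>N) = of_real (exp (- (S / 4)))" .
    have bound: "norm ((\<integral>\<omega>. cis (\<Sum>p\<in>?I. Re (cnj (a p) * X n \<omega> p)) \<partial>M n)
        - of_real (exp (- (S / (4 * real (n - m))) * n))) \<le> real m * S / (2 * real (n - m))" if n: "n > m" for n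
    proof -
      let ?\<mu> = "distr (M n) (unitary_borel n) (U n)"
      interpret haar_unitary n ?\<mu> by (rule haar_unitary_distr[OF assms(2)[OF n]])
      have "(\<Sum>p\<in>?I. Re (cnj (a p) * X n \<omega> p)) = sqrt n * truncation_form m b (U n \<omega>)" for \<omega>
      proof -
        have "(\<Sum>p\<in>?I. Re (cnj (a p) * X n \<omega> p)) = (\<Sum>i<m. \<Sum>j<m. Re (cnj (a (i, j)) * X n \<omega> (i, j)))"
          by (simp add: sum.cartesian_product case_prod_unfold)
        also have "\<dots> = (\<Sum>i<m. \<Sum>j<m. Re (of_real (sqrt n) * (cnj (b i j) * U n \<omega> $$ (i, j))))"
          by (intro sum.cong refl) (simp add: X_def b_def real_sqrt_divide field_simps)
        also have "\<dots> = sqrt n * truncation_form m b (U n \<omega>)"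
          by (simp add: truncation_form_def row_form_def sum_distrib_left distrib_left sum.distrib)
        finally show ?thesis .
      qed
      then have "(\<integral>\<omega>. cis (\<Sum>p\<in>?I. Re (cnj (a p) * X n \<omega> p)) \<partial>M n) = (\<integral>A. cis (sqrt n * truncation_form m b A) \<partial>?\<mu>)"
        using integral_distr[OF UM[OF n], of "\<lambda>A. cis (sqrt n * truncation_form m b A)"]
          cis_truncation_form_borel[of m "sqrt n" b] n by simp
      then show ?thesis using truncation_char_bound[OF n, of b] by (simp add: S_def)
    qed
    \<comment> \<open>The comparison Gaussian depends on \<open>n\<close> through n / (n - m). Hence
      two limits are taken: the difference tends to 0, and the exponent tends to -S / 4.\<close>
    have "(\<lambda>n. (\<integral>\<omega>. cis (\<Sum>p\<in>?I. Re (cnj (a p) * X n \<omega> p)) \<partial>M n)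
        - complex_of_real (exp (- (S / (4 * real (n - m))) * n))) \<longlonglongrightarrow> 0"
    proof (rule Lim_null_comparison)
      show "\<forall>\<^sub>F n in sequentially. norm ((\<integral>\<omega>. cis (\<Sum>p\<in>?I. Re (cnj (a p) * X n \<omega> p)) \<partial>M n)
        - of_real (exp (- (S / (4 * real (n - m))) * n))) \<le> real m * S / (2 * real (n - m))"
        using eventually_gt_at_top[of m] by eventually_elim (rule bound)
      \<comment> \<open>The limit is computed with real subtraction, which agrees with the truncated
        one for n > m.\<close>
      have "(\<lambda>n. real m * S / (2 * (real n - real m))) \<longlonglongrightarrow> 0" by real_asymp
      then show "(\<lambda>n. real m * S / (2 * real (n - m))) \<longlonglongrightarrow> 0"
        by (rule Lim_transform_eventually)
          (rule eventually_mono[OF eventually_gt_at_top[of m]], simp add: of_nat_diff)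
    qed
    moreover have "(\<lambda>n. exp (- (S / (4 * real (n - m))) * n)) \<longlonglongrightarrow> exp (- (S / 4))"
    proof (rule tendsto_exp)
      have "(\<lambda>n. - (S / (4 * (real n - real m))) * n) \<longlonglongrightarrow> - (S / 4)" by real_asymp
      then show "(\<lambda>n. - (S / (4 * real (n - m))) * n) \<longlonglongrightarrow> - (S / 4)"
        by (rule Lim_transform_eventually)
          (rule eventually_mono[OF eventually_gt_at_top[of m]], simp add: of_nat_diff)
    qed
    ultimately show ?thesis
      unfolding limit using tendsto_add[OF _ tendsto_of_real] by fastforce
  qed

  have tight: "\<exists>R0. \<forall>R\<ge>R0. \<forall>\<^sub>F n in sequentially.
      measure (M n) {\<omega> \<in> space (M n). \<exists>p\<in>?I. norm (X n \<omega> p) > R} < e" if e: "e > 0" for e :: real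
  proof (intro exI allI impI)
    \<comment> \<open>R \<ge> 1 gives R^2 \<ge> R, and the added 1 makes R > m / e strict, so the
      tail bound m / R^2 falls below e.\<close>
    fix R :: real assume "max 1 (m / e + 1) \<le> R"
    then have R: "R \<ge> 1" "R > m / e" by auto
    have "m / e < R\<^sup>2"
      using R self_le_power[of R 2] by simp
    then have less: "m / R\<^sup>2 < e" using R e by (simp add: field_simps)
    show "\<forall>\<^sub>F n in sequentially. measure (M n) {\<omega> \<in> space (M n). \<exists>p\<in>?I. norm (X n \<omega> p) > R} < e"
      using eventually_gt_at_top[of m]
    proof eventually_elim
      case (elim n)
      let ?\<mu> = "distr (M n) (unitary_borel n) (U n)"
      interpret haar_unitary n ?\<mu> by (rule haar_unitary_distr[OF assms(2)[OF elim]])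
      let ?E = "{A \<in> space ?\<mu>. \<exists>p\<in>?I. norm (complex_of_real (sqrt (n / m)) * A $$ p) > R}"
      have [measurable]: "(\<lambda>A. A $$ p) \<in> borel_measurable ?\<mu>" if "p \<in> ?I" for p
        using unitary_entry_measurable[of "fst p" n "snd p"] that elim by (auto simp: measurable_distr_eq1)
      have "?E \<in> sets ?\<mu>" by measurable
      then have "measure ?\<mu> ?E = measure (M n) (U n -` ?E \<inter> space (M n))"
        by (intro measure_distr UM elim) simp
      also have "U n -` ?E \<inter> space (M n) = {\<omega> \<in> space (M n). \<exists>p\<in>?I. norm (X n \<omega> p) > R}"
        using measurable_space[OF UM[OF elim]] by (auto simp: X_def)
      finally show ?case
        using truncation_tail[of m R] m R elim less by simp
    qed
  qed

  show ?thesis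
    unfolding converges_in_distribution_def
  proof (intro conjI allI impI)
    show "\<forall>\<^sub>F n in sequentially. prob_space (M n) \<and> ?T n \<in> M n \<rightarrow>\<^sub>M borel_on (mat_topology m)"
      using eventually_gt_at_top[of m] by eventually_elim (intro conjI probM TM)
  next
    fix f :: "complex mat \<Rightarrow> real"
    assume f: "continuous_map (mat_topology m) euclideanreal f \<and> bounded (f ` topspace (mat_topology m))"
    then obtain B where B: "\<And>A. A \<in> carrier_mat m m \<Longrightarrow> \<bar>f A\<bar> \<le> B"
      unfolding bounded_iff by auto
    have fmeas: "f \<in> borel_measurable (borel_on (mat_topology m))"
      using measurable_borel_on f by (metis borel_on_euclidean)
    \<comment> \<open>Composing \<open>f\<close> with the assembly of a matrix from its entries
      gives a bounded continuous function on the whole function space, although \<open>f\<close> is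
      controlled only on matrices of the right size.\<close>
    have "(\<lambda>n. \<integral>\<omega>. f (mat m m (X n \<omega>)) \<partial>M n) \<longlonglongrightarrow> (\<integral>\<omega>. f (mat m m (Y \<omega>)) \<partial>N)"
    proof (rule levy_continuity_complex_vectors[where I="?I" and f="\<lambda>x. f (mat m m x)"])
      show "\<forall>\<^sub>F n in sequentially. prob_space (M n) \<and> (\<forall>i\<in>?I. (\<lambda>\<omega>. X n \<omega> i) \<in> borel_measurable (M n))
          \<and> (\<lambda>\<omega>. f (mat m m (X n \<omega>))) \<in> borel_measurable (M n)"
        using eventually_gt_at_top[of m]
      proof eventually_elim
        case (elim n)
        then show ?case
          using probM Xmeas measurable_compose[OF TM fmeas] by (simp add: Xmat)
      qed
      show "(\<lambda>\<omega>. f (mat m m (Y \<omega>))) \<in> borel_measurable N"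
        using measurable_compose[OF GN fmeas] by (subst measurable_cong[OF arg_cong[where f=f, OF Gmat[symmetric]]])
      show "continuous_on UNIV (\<lambda>x. f (mat m m x))"
      proof -
        have "continuous_map euclidean (mat_topology m) (\<lambda>x. mat m m x :: complex mat)"
          by (rule continuous_map_mat_topologyI) auto
        then have "continuous_map euclidean euclideanreal (\<lambda>x. f (mat m m x))"
          using continuous_map_compose[of euclidean "mat_topology m" _ euclideanreal f] f by (simp add: o_def)
        then show ?thesis by simp
      qed
      show "\<bar>f (mat m m x)\<bar> \<le> B" for x by (rule B) simp
      show "X n \<omega> p = 0" "Y \<omega>' p = 0" if "p \<notin> ?I" for n \<omega> \<omega>' p
        using that unfolding X_def Y_def by auto
    qed (fact finite_cartesian_product[OF finite_lessThan finite_lessThan] N Ymeas char tight)+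
    moreover have "(\<integral>\<omega>. f (mat m m (Y \<omega>)) \<partial>N) = (\<integral>\<omega>. f (G \<omega>) \<partial>N)"
      by (intro Bochner_Integration.integral_cong refl) (simp add: Gmat[symmetric])
    ultimately show "(\<lambda>n. \<integral>\<omega>. f (?T n \<omega>) \<partial>M n) \<longlonglongrightarrow> (\<integral>\<omega>. f (G \<omega>) \<partial>N)"
      by (simp add: Xmat)
  qed (rule N GN)+
qed

end
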